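(* Let $\pi$ be any (fixed) classical permutation pattern. Let $s$ be the greatest number of inversions in a component of $\pi$, and let $s'$ be the greatest number of inversions in a component of $\overline{\pi}$. Let $m=m(n)$ and let $\boldsymbol{\sigma}_{n,m}$ be a uniformly random $n$-permutation with exactly $m$ inversions. (i) If $s>0$, then \[ \lim_{n\to\infty}\mathbb{P}\big[\boldsymbol{\sigma}_{n,m}\text{ contains }\pi\big]= \begin{cases} 0 & \text{if } m\ll n^{1-1/s},\\ 1 & \text{if } n^{1-1/s}\ll m\ll n. \end{cases} \] (ii) If $s'>0$, then \[ \lim_{n\to\infty}\mathbb{P}\big[\boldsymbol{\sigma}_{n,m}\text{ contains }\pi\big]= \begin{cases} 1 & \text{if } n\gg \binom n2-m\gg n^{1-1/s'},\\ 0 & \text{if } \binom n2-m\ll n^{1-1/s'}. \end{cases} \]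
   Context: An $n$-permutation is an arrangement $\sigma=\sigma(1)\ldots\sigma(n)$ of $[n]=\{1,\dots,n\}$. Its complement $\overline{\sigma}$ is given by $\overline{\sigma}(i)=n+1-\sigma(i)$. An inversion of $\sigma$ is a pair $i<j$ with $\sigma(i)>\sigma(j)$. For an integer $m$ with $0\le m\le\binom n2$, $\boldsymbol{\sigma}_{n,m}$ is chosen uniformly at random from the set of $n$-permutations with exactly $m$ inversions. Here $m=m(n)$ is an integer-valued function of $n$. A permutation $\sigma$ contains the classical pattern $\pi$ if $\sigma$ has a (not necessarily consecutive) subsequence whose terms have the same relative order as $\pi$. The direct sum $\sigma\oplus\tau$ of permutations $\sigma,\tau$ of lengths $k,\ell$ is the permutation of length $k+\ell$ with $(\sigma\oplus\tau)(i)=\sigma(i)$ for $i\le k$ and $(\sigma\oplus\tau)(i)=k+\tau(i-k)$ for $k+1\le i\le k+\ell$. An $n$-permutation $\sigma$ is decomposable if $\{\sigma(1),\dots,\sigma(k)\}=\{1,\dots,k\}$ for some $1\le k<n$, and otherwise is indecomposable. Every permutation has a unique representation as a direct sum of a sequence of one or more indecomposable permutations, called its components. Notation: $f\ll g$ (equivalently $g\gg f$) means $\lim_{n\to\infty}f/g=0$. *)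

theory Defs
  imports
    "HOL-Probability.Probability"
    "HOL-Combinatorics.Multiset_Permutations"
    "HOL-Library.Sublist"
    "HOL-Library.Landau_Symbols"
begin

text \<open>
  An \<open>n\<close>-permutation is the word \<open>\<sigma>(1) \<dots> \<sigma>(n)\<close>, represented as a list. The values are
  \<open>1, \<dots>, n\<close>, but list positions count from \<open>0\<close>, so \<open>\<sigma>(i)\<close> is \<open>\<sigma> ! (i - 1)\<close>.
\<close>

definition n_permutations :: "nat \<Rightarrow> nat list set" where
  "n_permutations n = permutations_of_set {1..n}"

definition complement_perm :: "nat list \<Rightarrow> nat list" where
  "complement_perm \<sigma> = map (\<lambda>x. length \<sigma> + 1 - x) \<sigma>"

definition inversions :: "nat list \<Rightarrow> nat" where
  "inversions \<sigma> = card {(i, j). i < j \<and> j < length \<sigma> \<and> \<sigma> ! i > \<sigma> ! j}"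

definition same_relative_order :: "nat list \<Rightarrow> nat list \<Rightarrow> bool" where
  "same_relative_order xs ys \<longleftrightarrow>
     length xs = length ys \<and>
     (\<forall>i < length xs. \<forall>j < length xs. xs ! i < xs ! j \<longleftrightarrow> ys ! i < ys ! j)"

definition contains_pattern :: "nat list \<Rightarrow> nat list \<Rightarrow> bool" where
  "contains_pattern \<sigma> \<pi> \<longleftrightarrow> (\<exists>xs. subseq xs \<sigma> \<and> same_relative_order xs \<pi>)"

definition direct_sum :: "nat list \<Rightarrow> nat list \<Rightarrow> nat list" where
  "direct_sum \<sigma> \<tau> = \<sigma> @ map (\<lambda>x. length \<sigma> + x) \<tau>"

definition decomposable :: "nat list \<Rightarrow> bool" where
  "decomposable \<sigma> \<longleftrightarrow> (\<exists>k. 1 \<le> k \<and> k < length \<sigma> \<and> set (take k \<sigma>) = {1..k})"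

text \<open>
  The empty permutation is excluded here: it is the neutral element of the direct sum,
  and admitting it would destroy the uniqueness of the decomposition.
\<close>

definition indecomposable :: "nat list \<Rightarrow> bool" where
  "indecomposable \<sigma> \<longleftrightarrow>
     \<sigma> \<in> n_permutations (length \<sigma>) \<and> \<sigma> \<noteq> [] \<and> \<not> decomposable \<sigma>"

definition decomposition :: "nat list list \<Rightarrow> nat list \<Rightarrow> bool" where
  "decomposition cs \<pi> \<longleftrightarrow> (\<forall>c \<in> set cs. indecomposable c) \<and> foldr direct_sum cs [] = \<pi>"

definition perm_components :: "nat list \<Rightarrow> nat list list" where
  "perm_components \<pi> = (THE cs. decomposition cs \<pi>)"

definition max_component_inversions :: "nat list \<Rightarrow> nat" where
  "max_component_inversions \<pi> = Max (inversions ` set (perm_components \<pi>))"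

text \<open>
  The set below is nonempty exactly when \<open>m \<le> n choose 2\<close>; for other \<open>m\<close> the value of
  \<^const>\<open>pmf_of_set\<close> is unspecified.
\<close>

definition random_perm :: "nat \<Rightarrow> nat \<Rightarrow> nat list pmf" where
  "random_perm n m = pmf_of_set {\<sigma> \<in> n_permutations n. inversions \<sigma> = m}"


subsection \<open>Existence and uniqueness of the decomposition into components\<close>

lemma direct_sum_Nil [simp]: "direct_sum [] \<tau> = \<tau>" "direct_sum \<sigma> [] = \<sigma>"
  by (simp_all add: direct_sum_def)

lemma direct_sum_assoc:
  "direct_sum (direct_sum \<rho> \<sigma>) \<tau> = direct_sum \<rho> (direct_sum \<sigma> \<tau>)"
  by (simp add: direct_sum_def add.assoc)

lemma foldr_direct_sum: "foldr direct_sum cs \<tau> = direct_sum (foldr direct_sum cs []) \<tau>"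
  by (induction cs) (simp_all add: direct_sum_assoc)

lemma foldr_direct_sum_append:
  "foldr direct_sum (cs @ ds) [] = direct_sum (foldr direct_sum cs []) (foldr direct_sum ds [])"
  by (simp add: foldr_direct_sum[of cs "foldr direct_sum ds []"])

lemma n_permutations_iff: "\<sigma> \<in> n_permutations n \<longleftrightarrow> set \<sigma> = {1..n} \<and> distinct \<sigma>"
  by (auto simp: n_permutations_def permutations_of_set_def)

lemma n_permutations_length: "\<sigma> \<in> n_permutations n \<Longrightarrow> length \<sigma> = n"
  by (metis n_permutations_iff distinct_card card_atLeastAtMost diff_Suc_1)

lemma direct_sum_indecomposable_length:
  assumes "indecomposable c" "indecomposable d" "direct_sum c \<sigma> = direct_sum d \<tau>"
  shows "length d \<le> length c"
proof (rule ccontr)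
  assume l: "\<not> length d \<le> length c"
  have "take (length c) d = take (length c) (direct_sum d \<tau>)"
    using l by (simp add: direct_sum_def)
  also have "\<dots> = take (length c) (direct_sum c \<sigma>)" by (simp add: assms(3))
  also have "\<dots> = c" by (simp add: direct_sum_def)
  finally have "set (take (length c) d) = {1..length c}"
    using assms(1) by (auto simp: indecomposable_def n_permutations_iff)
  moreover have "1 \<le> length c" using assms(1) by (cases c) (auto simp: indecomposable_def)
  ultimately have "decomposable d" using l by (auto simp: decomposable_def not_le)
  thus False using assms(2) by (simp add: indecomposable_def)
qed

lemma direct_sum_indecomposable_cancel:
  assumes "indecomposable c" "indecomposable d" "direct_sum c \<sigma> = direct_sum d \<tau>"
  shows "c = d" "\<sigma> = \<tau>"
proof -
  have l: "length c = length d"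
    using direct_sum_indecomposable_length[OF assms]
      direct_sum_indecomposable_length[OF assms(2,1) assms(3)[symmetric]] by simp
  thus "c = d" using assms(3) by (simp add: direct_sum_def)
  show "\<sigma> = \<tau>"
    using assms(3) l by (auto simp: direct_sum_def inj_on_def dest: map_injective)
qed

lemma decomposition_unique:
  "\<lbrakk>decomposition cs \<pi>; decomposition ds \<pi>\<rbrakk> \<Longrightarrow> cs = ds"
proof (induction cs arbitrary: ds \<pi>)
  case Nil
  then show ?case
    by (cases ds) (auto simp: decomposition_def indecomposable_def direct_sum_def)
next
  case (Cons c cs)
  then obtain d ds' where ds: "ds = d # ds'"
    by (cases ds) (auto simp: decomposition_def indecomposable_def direct_sum_def)
  have "c = d \<and> foldr direct_sum cs [] = foldr direct_sum ds' []"
    using direct_sum_indecomposable_cancel[of c d "foldr direct_sum cs []" "foldr direct_sum ds' []"]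
      Cons.prems by (simp add: decomposition_def ds)
  moreover from this have "cs = ds'"
    using Cons.IH[of "foldr direct_sum cs []" ds'] Cons.prems by (simp add: decomposition_def ds)
  ultimately show ?case by (simp add: ds)
qed

lemma decomposition_exists: "\<pi> \<in> n_permutations n \<Longrightarrow> \<exists>cs. decomposition cs \<pi>"
proof (induction n arbitrary: \<pi> rule: less_induct)
  case (less n)
  note len = n_permutations_length[OF less.prems]
  consider "\<pi> = []" | "\<pi> \<noteq> []" "\<not> decomposable \<pi>" | "decomposable \<pi>" by blast
  then show ?case
  proof cases
    case 1
    then have "decomposition [] \<pi>" by (simp add: decomposition_def)
    then show ?thesis ..
  next
    case 2
    then have "decomposition [\<pi>] \<pi>"
      using less.prems len by (simp add: decomposition_def indecomposable_def)
    then show ?thesis ..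
  next
    case 3
    then obtain k where k: "1 \<le> k" "k < n" "set (take k \<pi>) = {1..k}"
      by (auto simp: decomposable_def len)
    have dis: "distinct \<pi>" and set: "set \<pi> = {1..n}"
      using less.prems by (auto simp: n_permutations_iff)
    have "set \<pi> = set (take k \<pi>) \<union> set (drop k \<pi>)"
      by (metis append_take_drop_id set_append)
    moreover have "set (take k \<pi>) \<inter> set (drop k \<pi>) = {}"
      by (rule set_take_disj_set_drop_if_distinct[OF dis order_refl])
    ultimately have "set (drop k \<pi>) = {1..n} - {1..k}"
      using set k(3) by blast
    also have "\<dots> = {k+1..n}" by auto
    finally have sd: "set (drop k \<pi>) = {k+1..n}" .
    define \<tau> where "\<tau> = map (\<lambda>x. x - k) (drop k \<pi>)"
    have "(\<lambda>x. x - k) ` {k+1..n} = {1..n-k}"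
    proof (intro equalityI subsetI)
      fix y assume "y \<in> {1..n-k}"
      then show "y \<in> (\<lambda>x. x - k) ` {k+1..n}" by (intro image_eqI[of _ _ "y + k"]) auto
    qed auto
    moreover have "inj_on (\<lambda>x. x - k) {k+1..n}" by (auto simp: inj_on_def)
    ultimately have \<tau>: "\<tau> \<in> n_permutations (n - k)"
      using dis sd by (simp add: \<tau>_def n_permutations_iff distinct_map)
    have \<sigma>: "take k \<pi> \<in> n_permutations k"
      using dis k by (simp add: n_permutations_iff)
    have "map (\<lambda>x. k + x) \<tau> = drop k \<pi>"
      unfolding \<tau>_def map_map by (rule map_idI) (use sd in auto)
    then have eq: "direct_sum (take k \<pi>) \<tau> = \<pi>"
      using k by (simp add: direct_sum_def len min_def)
    obtain cs where "decomposition cs (take k \<pi>)" using less.IH[OF k(2) \<sigma>] by blast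
    moreover obtain ds where "decomposition ds \<tau>" using less.IH[OF _ \<tau>] k by auto
    ultimately have "decomposition (cs @ ds) \<pi>"
      using eq by (auto simp: decomposition_def foldr_direct_sum_append simp del: foldr_append)
    then show ?thesis ..
  qed
qed

theorem decomposition_ex1: "\<pi> \<in> n_permutations n \<Longrightarrow> \<exists>!cs. decomposition cs \<pi>"
  using decomposition_exists decomposition_unique by blast

lemma perm_components_eqI: "decomposition cs \<pi> \<Longrightarrow> perm_components \<pi> = cs"
  unfolding perm_components_def using decomposition_unique by blast

lemma decomposition_perm_components:
  "\<pi> \<in> n_permutations n \<Longrightarrow> decomposition (perm_components \<pi>) \<pi>"
  using decomposition_exists perm_components_eqI by blast

end

theory Submission
  imports Defs
begin

text \<open>
  A permutation \<open>\<sigma>\<close> is encoded by its inversion table \<open>e\<close>, where \<open>e(j)\<close> is the number of \<open>i < j\<close>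
  with \<open>\<sigma>(i) > \<sigma>(j)\<close>. With positions counted from \<open>0\<close>, this is a bijection onto the functions with
  \<open>e(j) \<le> j\<close>, and the number of inversions becomes the sum of the entries
  (\<open>bij_betw_inv_table\<close>). So a random permutation with \<open>m\<close> inversions is a random table of sum \<open>m\<close>.
  Double counting the ways to increment one entry shows that lowering the sum by one multiplies the
  number of tables by a factor between \<open>m / (n + m)\<close> and \<open>m / (n - m)\<close>. For \<open>m\<close> large but much
  smaller than \<open>n\<close>, prescribing entries of total \<open>t\<close> on a bounded window far from the start
  therefore has probability about \<open>(m / n) ^ t\<close>.

  Below the threshold: an occurrence of a component with \<open>s\<close> inversions forces a window of bounded
  length on which \<open>e\<close> has sum at least \<open>s\<close> (\<open>heavy_window_if_contains\<close>). There are about \<open>n\<close>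
  windows, so the probability is of order at most \<open>n * (m / n) ^ s\<close>, which tends to \<open>0\<close> exactly when
  \<open>m\<close> is much smaller than \<open>n powr (1 - 1 / s)\<close>.

  Above the threshold: if a window of \<open>e\<close> repeats the table of a component, then \<open>\<sigma>\<close> has a copy of
  the component there, lying above all earlier entries (\<open>window_order\<close>). Windows for the successive
  components in successive stretches of positions thus give the pattern (\<open>contains_if_windows\<close>).
  In a stretch of linear length the expected number of windows that match a component with
  \<open>t \<le> s\<close> inversions is of order \<open>n * (m / n) ^ t\<close> and tends to infinity. Matches in disjoint windows
  are asymptotically uncorrelated, so the second moment method yields a match with probability
  tending to \<open>1\<close> (\<open>some_match_tendsto_1\<close>).

  The dense regime is the sparse one for the complement, which reverses the roles of inversions and
  non-inversions and preserves containment (\<open>contain_prob_complement\<close>).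
\<close>

section \<open>Inversion tables\<close>

text \<open>
  The number of earlier larger entries: the inversion table (Lehmer code) of a permutation. It
  is extended by \<open>0\<close> beyond the word, so that tables are total functions that can be added and
  compared pointwise.
\<close>

definition inv_table :: "nat list \<Rightarrow> nat \<Rightarrow> nat" where
  "inv_table \<sigma> j = (if j < length \<sigma> then card {i. i < j \<and> \<sigma> ! j < \<sigma> ! i} else 0)"

definition inv_tables :: "nat \<Rightarrow> nat \<Rightarrow> (nat \<Rightarrow> nat) set" where
  "inv_tables n m = {e. (\<forall>j. e j \<le> j) \<and> (\<forall>j\<ge>n. e j = 0) \<and> sum e {..<n} = m}"

lemma inv_table_le: "inv_table \<sigma> j \<le> j"
proof -
  have "card {i. i < j \<and> \<sigma> ! j < \<sigma> ! i} \<le> card {..<j}"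
    by (intro card_mono) auto
  then show ?thesis by (simp add: inv_table_def)
qed

lemma inversions_eq_sum_inv_table: "inversions \<sigma> = sum (inv_table \<sigma>) {..<length \<sigma>}"
proof -
  have eq: "{(i, j). i < j \<and> j < length \<sigma> \<and> \<sigma> ! i > \<sigma> ! j}
     = prod.swap ` (SIGMA j:{..<length \<sigma>}. {i. i < j \<and> \<sigma> ! j < \<sigma> ! i})"
    by (auto simp: image_iff)
  have "inversions \<sigma> = card (SIGMA j:{..<length \<sigma>}. {i. i < j \<and> \<sigma> ! j < \<sigma> ! i})"
    unfolding inversions_def eq by (rule card_image) (auto simp: inj_on_def)
  also have "\<dots> = (\<Sum>j<length \<sigma>. card {i. i < j \<and> \<sigma> ! j < \<sigma> ! i})"
    by (rule card_SigmaI) auto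
  also have "\<dots> = sum (inv_table \<sigma>) {..<length \<sigma>}"
    by (rule sum.cong) (auto simp: inv_table_def)
  finally show ?thesis .
qed

text \<open>
  The up-sets of a linear order form a chain, so their cardinality determines them.
\<close>

lemma upset_eq_if_card_eq:
  fixes g :: "nat \<Rightarrow> nat"
  assumes fin: "finite A" and U: "U \<subseteq> A" and V: "V \<subseteq> A" and card: "card U = card V"
    and upU: "\<And>x y. x \<in> U \<Longrightarrow> y \<in> A \<Longrightarrow> g x < g y \<Longrightarrow> y \<in> U"
    and upV: "\<And>x y. x \<in> V \<Longrightarrow> y \<in> A \<Longrightarrow> g x < g y \<Longrightarrow> y \<in> V"
    and inj: "inj_on g A"
  shows "U = V"
proof -
  have fU: "finite U" and fV: "finite V" using fin U V finite_subset by blast+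
  have "U \<subseteq> V \<or> V \<subseteq> U"
  proof (rule ccontr)
    assume "\<not> ?thesis"
    then obtain x y where xy: "x \<in> U" "x \<notin> V" "y \<in> V" "y \<notin> U" by blast
    then have "g x \<noteq> g y" using inj U V by (metis inj_onD subsetD)
    then consider "g x < g y" | "g y < g x" by linarith
    then show False using upU upV xy U V by cases blast+
  qed
  then show ?thesis using card card_subset_eq[OF fU] card_subset_eq[OF fV] by metis
qed

text \<open>
  The table of a window determines the relative order of its entries, provided that each entry
  \<open>inv_table \<sigma> (a + i)\<close> is at most \<open>i\<close>, as it is when the window repeats the table of some \<open>c\<close>.
  When position \<open>a + k\<close> is reached, the \<open>k\<close> window entries already placed are by induction the
  largest ones seen so far. The entries exceeding the new one form an up-set of size at most \<open>k\<close>,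
  so they lie inside the window, and an up-set is determined by its size. In particular the window
  starts a new block of a direct sum: it lies above everything before it.
\<close>

lemma window_order:
  assumes dis: "distinct \<sigma>" and disc: "distinct c" and len: "a + length c \<le> length \<sigma>"
    and match: "\<And>i. i < length c \<Longrightarrow> inv_table \<sigma> (a + i) = inv_table c i"
    and k: "k \<le> length c"
  shows "(\<forall>i<a. \<forall>j<k. \<sigma> ! i < \<sigma> ! (a + j)) \<and>
         (\<forall>i<k. \<forall>j<k. \<sigma> ! (a + i) < \<sigma> ! (a + j) \<longleftrightarrow> c ! i < c ! j)"
  using k
proof (induction k)
  case 0
  then show ?case by simp
next
  case (Suc k)
  then have below: "\<And>i j. i < a \<Longrightarrow> j < k \<Longrightarrow> \<sigma> ! i < \<sigma> ! (a + j)"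
    and ord: "\<And>i j. i < k \<Longrightarrow> j < k \<Longrightarrow> \<sigma> ! (a + i) < \<sigma> ! (a + j) \<longleftrightarrow> c ! i < c ! j"
    by auto
  have klen: "k < length c" using Suc.prems by simp
  define U where "U = {i. i < a + k \<and> \<sigma> ! (a + k) < \<sigma> ! i}"
  define V where "V = {i. i < k \<and> c ! k < c ! i}"
  have cardUV: "card U = card V"
    using match[OF klen] klen len by (simp add: inv_table_def U_def V_def)
  have cardV: "card V \<le> k"
    using card_mono[of "{..<k}" V] by (auto simp: V_def)
  have finU: "finite U" by (simp add: U_def)
  have Uwin: "a \<le> i" if "i \<in> U" for i
  proof (rule ccontr)
    assume i: "\<not> a \<le> i"
    \<comment> \<open>an early entry exceeding the new one drags all \<open>k\<close> earlier window entries with it\<close>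
    have "insert i {a..<a+k} \<subseteq> U"
    proof
      fix x assume "x \<in> insert i {a..<a+k}"
      then consider "x = i" | j where "x = a + j" "j < k"
        using le_Suc_ex by fastforce
      then show "x \<in> U"
      proof cases
        case 2
        then show ?thesis using that i below[of i j] by (auto simp: U_def)
      qed (use that in simp)
    qed
    from card_mono[OF finU this] have "Suc k \<le> card U" using i by simp
    with cardUV cardV show False by simp
  qed
  define U' where "U' = {i. i < k \<and> \<sigma> ! (a + k) < \<sigma> ! (a + i)}"
  have Uim: "U = (\<lambda>i. a + i) ` U'"
  proof
    show "U \<subseteq> (\<lambda>i. a + i) ` U'"
    proof
      fix x assume x: "x \<in> U"
      then have "x - a \<in> U'" "x = a + (x - a)" using Uwin[OF x] by (auto simp: U_def U'_def)
      then show "x \<in> (\<lambda>i. a + i) ` U'" by blast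
    qed
  qed (auto simp: U_def U'_def)
  have "card U = card U'" unfolding Uim by (rule card_image) auto
  have "U' = V"
  proof (rule upset_eq_if_card_eq[of "{..<k}" U' V "\<lambda>i. c ! i"])
    show "card U' = card V" using \<open>card U = card U'\<close> cardUV by simp
    show "inj_on (\<lambda>i. c ! i) {..<k}"
      using klen disc by (auto simp: inj_on_def nth_eq_iff_index_eq)
  next
    fix x y assume "x \<in> U'" "y \<in> {..<k}" "c ! x < c ! y"
    then show "y \<in> U'" using ord[of x y] by (auto simp: U'_def)
  qed (auto simp: U'_def V_def)
  then have new: "\<sigma> ! (a + k) < \<sigma> ! (a + i) \<longleftrightarrow> c ! k < c ! i" if "i < k" for i
    using that by (auto simp: U'_def V_def)
  have new': "\<sigma> ! (a + i) < \<sigma> ! (a + k) \<longleftrightarrow> c ! i < c ! k" if "i < k" for i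
  proof -
    have "\<sigma> ! (a + i) \<noteq> \<sigma> ! (a + k)" "c ! i \<noteq> c ! k"
      using that klen len dis disc by (auto simp: nth_eq_iff_index_eq)
    then show ?thesis using new[OF that] by linarith
  qed
  have bk: "\<sigma> ! i < \<sigma> ! (a + k)" if "i < a" for i
  proof -
    have "i \<notin> U" using Uwin that by force
    moreover have "\<sigma> ! i \<noteq> \<sigma> ! (a + k)"
      using that klen len dis by (auto simp: nth_eq_iff_index_eq)
    ultimately show ?thesis using that by (auto simp: U_def)
  qed
  show ?case
    using below ord new new' bk by (auto simp: less_Suc_eq)
qed

lemma n_permutations_nth:
  assumes "\<sigma> \<in> n_permutations n" "i < n"
  shows "1 \<le> \<sigma> ! i" "\<sigma> ! i \<le> n"
proof -
  have "\<sigma> ! i \<in> set \<sigma>" using assms n_permutations_length by (metis nth_mem)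
  also have "set \<sigma> = {1..n}" using assms(1) by (simp add: n_permutations_iff)
  finally show "1 \<le> \<sigma> ! i" "\<sigma> ! i \<le> n" by simp_all
qed

lemma n_permutations_eq_if_same_order:
  assumes "\<sigma> \<in> n_permutations n" "\<tau> \<in> n_permutations n" "same_relative_order \<sigma> \<tau>"
  shows "\<sigma> = \<tau>"
proof -
  have rank: "\<rho> ! i = Suc (card {j. j < n \<and> \<rho> ! j < \<rho> ! i})"
    if \<rho>: "\<rho> \<in> n_permutations n" and i: "i < n" for \<rho> i
  proof -
    have len: "length \<rho> = n" using \<rho> by (rule n_permutations_length)
    have set: "set \<rho> = {1..n}" and dis: "distinct \<rho>"
      using \<rho> by (simp_all add: n_permutations_iff)
    have pos: "\<rho> ! j \<ge> 1" "\<rho> ! j \<le> n" if "j < n" for j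
      using nth_mem[of j \<rho>] that by (simp_all add: set len)
    have "bij_betw (\<lambda>j. \<rho> ! j) {j. j < n \<and> \<rho> ! j < \<rho> ! i} {1..<\<rho> ! i}"
      unfolding bij_betw_def
    proof
      show "inj_on (\<lambda>j. \<rho> ! j) {j. j < n \<and> \<rho> ! j < \<rho> ! i}"
        using dis len by (auto simp: inj_on_def nth_eq_iff_index_eq)
      show "(\<lambda>j. \<rho> ! j) ` {j. j < n \<and> \<rho> ! j < \<rho> ! i} = {1..<\<rho> ! i}" (is "?L = ?R")
      proof
        show "?L \<subseteq> ?R" using pos by auto
        show "?R \<subseteq> ?L"
        proof
          fix x assume x: "x \<in> ?R"
          then have "x \<in> set \<rho>" using pos(2)[OF i] by (simp add: set)
          then show "x \<in> ?L" using x len by (auto simp: in_set_conv_nth)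
        qed
      qed
    qed
    then have "card {j. j < n \<and> \<rho> ! j < \<rho> ! i} = \<rho> ! i - 1"
      by (simp add: bij_betw_same_card)
    then show ?thesis using pos(1)[OF i] by simp
  qed
  have len: "length \<sigma> = n" "length \<tau> = n" using assms n_permutations_length by blast+
  show ?thesis
  proof (rule nth_equalityI)
    fix i assume "i < length \<sigma>"
    then have i: "i < n" using len by simp
    then have "{j. j < n \<and> \<sigma> ! j < \<sigma> ! i} = {j. j < n \<and> \<tau> ! j < \<tau> ! i}"
      using assms(3) len by (auto simp: same_relative_order_def)
    then show "\<sigma> ! i = \<tau> ! i" using rank[OF assms(1) i] rank[OF assms(2) i] by simp
  qed (simp add: len)
qed

text \<open>
  A window that is the whole word: the table determines the relative order, hence the
  permutation.
\<close>

lemma inj_on_inv_table: "inj_on inv_table (n_permutations n)"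
proof (rule inj_onI)
  fix \<sigma> \<tau> assume *: "\<sigma> \<in> n_permutations n" "\<tau> \<in> n_permutations n" "inv_table \<sigma> = inv_table \<tau>"
  then have "length \<sigma> = n" "length \<tau> = n" "distinct \<sigma>" "distinct \<tau>"
    using n_permutations_length by (auto simp: n_permutations_iff)
  with window_order[of \<sigma> \<tau> 0 n] *(3) have "same_relative_order \<sigma> \<tau>"
    by (simp add: same_relative_order_def)
  with * show "\<sigma> = \<tau>" by (intro n_permutations_eq_if_same_order)
qed

text \<open>
  There are \<open>n!\<close> tables, as many as permutations; together with injectivity this spares an
  explicit decoding of tables.
\<close>

lemma card_all_inv_tables:
  "finite {e::nat\<Rightarrow>nat. (\<forall>j. e j \<le> j) \<and> (\<forall>j\<ge>n. e j = 0)} \<and>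
   card {e::nat\<Rightarrow>nat. (\<forall>j. e j \<le> j) \<and> (\<forall>j\<ge>n. e j = 0)} = fact n"
proof (induction n)
  case 0
  have "{e::nat\<Rightarrow>nat. (\<forall>j. e j \<le> j) \<and> (\<forall>j\<ge>0. e j = 0)} = {\<lambda>_. 0}" by auto
  then show ?case by simp
next
  case (Suc n)
  let ?F = "\<lambda>n. {e::nat\<Rightarrow>nat. (\<forall>j. e j \<le> j) \<and> (\<forall>j\<ge>n. e j = 0)}"
  have eq: "?F (Suc n) = (\<lambda>(e, v). e(n := v)) ` (?F n \<times> {..n})"
  proof
    show "?F (Suc n) \<subseteq> (\<lambda>(e, v). e(n := v)) ` (?F n \<times> {..n})"
    proof
      fix e assume e: "e \<in> ?F (Suc n)"
      have "(e(n := 0), e n) \<in> ?F n \<times> {..n}"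
        using e by (auto simp: Suc_le_eq order_less_le)
      moreover have "e = (\<lambda>(e, v). e(n := v)) (e(n := 0), e n)" by simp
      ultimately show "e \<in> (\<lambda>(e, v). e(n := v)) ` (?F n \<times> {..n})" by (rule rev_image_eqI)
    qed
  qed auto
  have inj: "inj_on (\<lambda>(e, v). e(n := v)) (?F n \<times> {..n})"
  proof (rule inj_onI)
    fix x y assume x: "x \<in> ?F n \<times> {..n}" and y: "y \<in> ?F n \<times> {..n}"
      and eq: "(\<lambda>(e, v). e(n := v)) x = (\<lambda>(e, v). e(n := v)) y"
    obtain e v f w where *: "x = (e, v)" "y = (f, w)" by fastforce
    have v: "v = w" using eq * by (metis case_prod_conv fun_upd_same)
    have "e j = f j" for j
    proof (cases "j = n")
      case False
      then show ?thesis using eq * by (metis case_prod_conv fun_upd_other)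
    qed (use x y * in simp)
    then show "x = y" using * v by auto
  qed
  have "card (?F (Suc n)) = card (?F n \<times> {..n})" unfolding eq by (rule card_image[OF inj])
  also have "\<dots> = fact (Suc n)" using Suc by (simp add: card_cartesian_product)
  finally have "card (?F (Suc n)) = fact (Suc n)" .
  moreover have "finite (?F (Suc n))" unfolding eq using Suc by blast
  ultimately show ?case by blast
qed

lemma finite_inv_tables: "finite (inv_tables n m)"
  by (rule finite_subset[OF _ conjunct1[OF card_all_inv_tables[of n]]]) (auto simp: inv_tables_def)

lemma bij_betw_inv_table:
  "bij_betw inv_table {\<sigma> \<in> n_permutations n. inversions \<sigma> = m} (inv_tables n m)"
proof -
  let ?F = "{e::nat\<Rightarrow>nat. (\<forall>j. e j \<le> j) \<and> (\<forall>j\<ge>n. e j = 0)}"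
  have sub: "inv_table ` n_permutations n \<subseteq> ?F"
    by (auto simp: inv_table_le) (simp add: inv_table_def n_permutations_length)
  have "card (inv_table ` n_permutations n) = fact n"
    using card_image[OF inj_on_inv_table] by (simp add: n_permutations_def)
  then have img: "inv_table ` n_permutations n = ?F"
    using card_subset_eq[OF _ sub] card_all_inv_tables[of n] by metis
  have inv: "inversions \<sigma> = sum (inv_table \<sigma>) {..<n}" if "\<sigma> \<in> n_permutations n" for \<sigma>
    using inversions_eq_sum_inv_table n_permutations_length[OF that] by metis
  have "inv_table ` {\<sigma> \<in> n_permutations n. inversions \<sigma> = m} = {e \<in> ?F. sum e {..<n} = m}"
    unfolding img[symmetric] using inv by auto
  also have "\<dots> = inv_tables n m" by (auto simp: inv_tables_def)
  finally show ?thesis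
    unfolding bij_betw_def by (intro conjI inj_on_subset[OF inj_on_inv_table]) auto
qed

section \<open>Counting tables with a given sum\<close>

definition num_tables :: "nat \<Rightarrow> nat \<Rightarrow> nat" where
  "num_tables n m = card (inv_tables n m)"

lemma inv_tablesD:
  assumes "e \<in> inv_tables n m"
  shows "e j \<le> j" "n \<le> j \<Longrightarrow> e j = 0" "sum e {..<n} = m"
  using assms by (auto simp: inv_tables_def)

lemma inv_tables_entry_le: "e \<in> inv_tables n m \<Longrightarrow> e j \<le> m"
proof (cases "j < n")
  case True
  assume "e \<in> inv_tables n m"
  then show ?thesis using member_le_sum[of j "{..<n}" e] True by (auto simp: inv_tables_def)
qed (simp add: inv_tables_def)

text \<open>
  Incrementing an entry links the tables of sum \<open>m\<close> to those of sum \<open>m + 1\<close>. Counting the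
  pairs on both sides yields the two estimates of \<open>num_tables n (m + 1) / num_tables n m\<close> below.
\<close>

lemma bij_betw_increment:
  "bij_betw (\<lambda>(e, j). (e(j := Suc (e j)), j))
     {(e, j). e \<in> inv_tables n m \<and> j < n \<and> e j < j}
     {(e, j). e \<in> inv_tables n (Suc m) \<and> j < n \<and> 0 < e j}"
  (is "bij_betw ?f ?P ?Q")
proof (rule bij_betwI[where g = "\<lambda>(e, j). (e(j := e j - 1), j)"])
  have upd: "sum (e(j := v)) {..<n} + e j = sum e {..<n} + v" if "j < n" for e :: "nat \<Rightarrow> nat" and j v
    using that by (simp add: sum.remove[of "{..<n}" j])
  show "?f \<in> ?P \<rightarrow> ?Q"
  proof
    fix x assume "x \<in> ?P"
    then obtain e j where x: "x = (e, j)" "e \<in> inv_tables n m" "j < n" "e j < j" by auto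
    then show "?f x \<in> ?Q" using upd[of j e "Suc (e j)"] by (auto simp: inv_tables_def)
  qed
  show "(\<lambda>(e, j). (e(j := e j - 1), j)) \<in> ?Q \<rightarrow> ?P"
  proof
    fix x assume "x \<in> ?Q"
    then obtain e j where x: "x = (e, j)" "e \<in> inv_tables n (Suc m)" "j < n" "0 < e j" by auto
    have "e i - Suc 0 \<le> i" for i using inv_tablesD(1)[OF x(2), of i] by simp
    moreover have "e j - Suc 0 < j" using inv_tablesD(1)[OF x(2), of j] x(4) by simp
    ultimately show "(\<lambda>(e, j). (e(j := e j - 1), j)) x \<in> ?P"
      using x upd[of j e "e j - 1"] by (auto simp: inv_tables_def)
  qed
qed auto

text \<open>
  A table of sum \<open>m\<close> has at most \<open>m\<close> saturated entries besides the one at position \<open>0\<close>, so at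
  least \<open>n - (m + 1)\<close> entries can be incremented; a table of sum \<open>m + 1\<close> has at most \<open>m + 1\<close>
  positive entries that can be decremented.
\<close>

lemma num_tables_upper: "(n - Suc m) * num_tables n m \<le> Suc m * num_tables n (Suc m)"
proof -
  let ?P = "SIGMA e:inv_tables n m. {j. j < n \<and> e j < j}"
  let ?Q = "SIGMA e:inv_tables n (Suc m). {j. j < n \<and> 0 < e j}"
  have "(n - Suc m) * num_tables n m = (\<Sum>e\<in>inv_tables n m. n - Suc m)"
    by (simp add: num_tables_def)
  also have "\<dots> \<le> (\<Sum>e\<in>inv_tables n m. card {j. j < n \<and> e j < j})"
  proof (rule sum_mono)
    fix e assume e: "e \<in> inv_tables n m"
    let ?full = "{j. 0 < j \<and> j < n \<and> e j = j}"
    have "card ?full = (\<Sum>j\<in>?full. 1)" by simp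
    also have "\<dots> \<le> sum e ?full" by (rule sum_mono) auto
    also have "\<dots> \<le> sum e {..<n}" by (rule sum_mono2) auto
    finally have full: "card ?full \<le> m" using inv_tablesD(3)[OF e] by simp
    have "n = card {..<n}" by simp
    also have "\<dots> \<le> card ({j. j < n \<and> e j < j} \<union> ?full \<union> {0})"
    proof (rule card_mono)
      show "{..<n} \<subseteq> {j. j < n \<and> e j < j} \<union> ?full \<union> {0}"
      proof
        fix j assume "j \<in> {..<n}"
        with inv_tablesD(1)[OF e, of j]
        show "j \<in> {j. j < n \<and> e j < j} \<union> ?full \<union> {0}" by simp linarith
      qed
    qed simp
    also have "\<dots> \<le> card {j. j < n \<and> e j < j} + card ?full + card {0::nat}"
      by (meson add_right_mono card_Un_le order_trans)
    finally show "n - Suc m \<le> card {j. j < n \<and> e j < j}" using full by simp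
  qed
  also have "\<dots> = card ?P" by (simp add: finite_inv_tables)
  also have "?P = {(e, j). e \<in> inv_tables n m \<and> j < n \<and> e j < j}" by auto
  also have "card \<dots> = card {(e, j). e \<in> inv_tables n (Suc m) \<and> j < n \<and> 0 < e j}"
    by (rule bij_betw_same_card[OF bij_betw_increment])
  also have "{(e, j). e \<in> inv_tables n (Suc m) \<and> j < n \<and> 0 < e j} = ?Q" by auto
  also have "card ?Q = (\<Sum>e\<in>inv_tables n (Suc m). card {j. j < n \<and> 0 < e j})"
    by (simp add: finite_inv_tables)
  also have "\<dots> \<le> (\<Sum>e\<in>inv_tables n (Suc m). Suc m)"
  proof (rule sum_mono)
    fix e assume e: "e \<in> inv_tables n (Suc m)"
    have "card {j. j < n \<and> 0 < e j} = (\<Sum>j\<in>{j. j < n \<and> 0 < e j}. 1)" by simp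
    also have "\<dots> \<le> sum e {j. j < n \<and> 0 < e j}" by (rule sum_mono) auto
    also have "\<dots> \<le> sum e {..<n}" by (rule sum_mono2) auto
    finally show "card {j. j < n \<and> 0 < e j} \<le> Suc m" using inv_tablesD(3)[OF e] by simp
  qed
  also have "\<dots> = Suc m * num_tables n (Suc m)" by (simp add: num_tables_def)
  finally show ?thesis .
qed

text \<open>
  The same pairs, each weighted by the size of the marked entry after the increment: on one
  side the weights of each table add up to \<open>m + 1\<close>, on the other side to at most \<open>n + m\<close>.
\<close>

lemma num_tables_lower: "Suc m * num_tables n (Suc m) \<le> (n + m) * num_tables n m"
proof -
  let ?P = "{(e, j). e \<in> inv_tables n m \<and> j < n \<and> e j < j}"
  let ?Q = "{(e, j). e \<in> inv_tables n (Suc m) \<and> j < n \<and> 0 < e j}"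
  have Q: "?Q = (SIGMA e:inv_tables n (Suc m). {j. j < n \<and> 0 < e j})" by auto
  have "Suc m * num_tables n (Suc m) = (\<Sum>e\<in>inv_tables n (Suc m). Suc m)"
    by (simp add: num_tables_def)
  also have "\<dots> = (\<Sum>e\<in>inv_tables n (Suc m). sum e {..<n})"
    by (rule sum.cong) (simp_all add: inv_tables_def)
  also have "\<dots> = (\<Sum>e\<in>inv_tables n (Suc m). sum e {j. j < n \<and> 0 < e j})"
    by (intro sum.cong refl sum.mono_neutral_right) auto
  also have "\<dots> = (\<Sum>(e, j)\<in>?Q. e j)"
    unfolding Q by (rule sum.Sigma) (auto simp: finite_inv_tables)
  also have "\<dots> = (\<Sum>(e, j)\<in>?P. Suc (e j))"
    using sum.reindex_bij_betw[OF bij_betw_increment[of n m], of "\<lambda>(e, j). e j"]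
    by (simp add: case_prod_unfold)
  also have "\<dots> \<le> (\<Sum>(e, j)\<in>inv_tables n m \<times> {..<n}. Suc (e j))"
    by (rule sum_mono2) (auto simp: finite_inv_tables)
  also have "\<dots> = (\<Sum>e\<in>inv_tables n m. \<Sum>j<n. Suc (e j))"
    by (simp add: sum.cartesian_product)
  also have "\<dots> = (\<Sum>e\<in>inv_tables n m. n + m)"
    by (rule sum.cong) (simp_all add: inv_tables_def sum_Suc)
  also have "\<dots> = (n + m) * num_tables n m" by (simp add: num_tables_def)
  finally show ?thesis .
qed

text \<open>
  Subtracting \<open>f\<close> from a table keeps it a table.
\<close>

lemma card_dominating_le:
  assumes "sum f {..<n} = t"
  shows "card {e \<in> inv_tables n m. \<forall>j. f j \<le> e j} \<le> (if t \<le> m then num_tables n (m - t) else 0)"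
proof (cases "t \<le> m")
  case True
  let ?A = "{e \<in> inv_tables n m. \<forall>j. f j \<le> e j}"
  have "inj_on (\<lambda>e j. e j - f j) ?A"
  proof (rule inj_onI, rule ext)
    fix x y j assume "x \<in> ?A" "y \<in> ?A" "(\<lambda>j. x j - f j) = (\<lambda>j. y j - f j)"
    then have "x j - f j = y j - f j" "f j \<le> x j" "f j \<le> y j" by (auto dest: fun_cong)
    then show "x j = y j" by linarith
  qed
  moreover have "(\<lambda>e j. e j - f j) ` ?A \<subseteq> inv_tables n (m - t)"
  proof
    fix d assume "d \<in> (\<lambda>e j. e j - f j) ` ?A"
    then obtain e where e: "e \<in> inv_tables n m" "\<forall>j. f j \<le> e j" "d = (\<lambda>j. e j - f j)" by auto
    have "sum d {..<n} = m - t"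
      using e assms inv_tablesD(3)[OF e(1)] by (simp add: sum_subtractf_nat)
    moreover have "e j - f j \<le> j" for j using inv_tablesD(1)[OF e(1), of j] by simp
    ultimately show "d \<in> inv_tables n (m - t)"
      using e inv_tablesD(2)[OF e(1)] by (auto simp: inv_tables_def)
  qed
  ultimately have "card ?A \<le> num_tables n (m - t)"
    unfolding num_tables_def using card_inj_on_le finite_inv_tables by blast
  with True show ?thesis by simp
next
  case False
  have "{e \<in> inv_tables n m. \<forall>j. f j \<le> e j} = {}"
  proof (rule ccontr)
    assume "\<not> ?thesis"
    then obtain e where "e \<in> inv_tables n m" "\<forall>j. f j \<le> e j" by auto
    then have "t \<le> m" using sum_mono[of "{..<n}" f e] assms by (auto simp: inv_tables_def)
    with False show False by simp
  qed
  then have "card {e \<in> inv_tables n m. \<forall>j. f j \<le> e j} = 0" by (simp only: card.empty)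
  then show ?thesis by simp
qed

text \<open>
  Adding \<open>f\<close> may violate the bound \<open>e j \<le> j\<close>, but not at positions \<open>j \<ge> m\<close>: no entry of a
  table exceeds its sum.
\<close>

lemma card_dominating_eq:
  assumes f: "sum f {..<n} = t" and supp: "\<And>j. 0 < f j \<Longrightarrow> m \<le> j \<and> j < n" and t: "t \<le> m"
  shows "card {e \<in> inv_tables n m. \<forall>j. f j \<le> e j} = num_tables n (m - t)"
proof (rule antisym)
  show "card {e \<in> inv_tables n m. \<forall>j. f j \<le> e j} \<le> num_tables n (m - t)"
    using card_dominating_le[OF f, of m] t by simp
  have "inj_on (\<lambda>d j. d j + f j) (inv_tables n (m - t))"
    by (rule inj_onI) (simp add: fun_eq_iff)
  moreover have "(\<lambda>d j. d j + f j) ` inv_tables n (m - t) \<subseteq> {e \<in> inv_tables n m. \<forall>j. f j \<le> e j}"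
  proof
    fix e assume "e \<in> (\<lambda>d j. d j + f j) ` inv_tables n (m - t)"
    then obtain d where d: "d \<in> inv_tables n (m - t)" and e: "e = (\<lambda>j. d j + f j)" by auto
    have ft: "f j \<le> t" for j
    proof (cases "f j > 0")
      case True
      then show ?thesis using member_le_sum[of j "{..<n}" f] supp f by auto
    qed simp
    have "d j + f j \<le> j" for j
    proof (cases "f j > 0")
      case True
      then have "m \<le> j" using supp by blast
      with ft[of j] inv_tables_entry_le[OF d, of j] t show ?thesis by linarith
    qed (use inv_tablesD(1)[OF d] in simp)
    moreover have "d j + f j = 0" if "n \<le> j" for j
      using supp[of j] inv_tablesD(2)[OF d, of j] that by fastforce
    moreover have "sum e {..<n} = m"
      using f t inv_tablesD(3)[OF d] by (simp add: e sum.distrib)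
    ultimately show "e \<in> {e \<in> inv_tables n m. \<forall>j. f j \<le> e j}"
      by (auto simp: inv_tables_def e)
  qed
  ultimately show "num_tables n (m - t) \<le> card {e \<in> inv_tables n m. \<forall>j. f j \<le> e j}"
    unfolding num_tables_def by (rule card_inj_on_le) (simp add: finite_inv_tables)
qed

lemma num_tables_pos: "m < n \<Longrightarrow> 0 < num_tables n m"
proof (induction m)
  case 0
  have "(\<lambda>_. 0) \<in> inv_tables n 0" by (simp add: inv_tables_def)
  then show ?case using finite_inv_tables by (auto simp: num_tables_def card_gt_0_iff)
next
  case (Suc m)
  then have "0 < (n - Suc m) * num_tables n m" by simp
  then have "0 < Suc m * num_tables n (Suc m)" using num_tables_upper[of n m] by linarith
  then show ?case by (cases "num_tables n (Suc m)") simp_all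
qed

text \<open>
  Iterating the one-step estimates. For \<open>m\<close> large but much smaller than \<open>n\<close>, this bound and the
  next one agree to first order: prescribing \<open>t\<close> inversions costs a factor \<open>(m / n) ^ t\<close>.
\<close>

lemma num_tables_drop_upper:
  assumes "t \<le> m" "m < n"
  shows "real (num_tables n (m - t)) \<le> (real m / (real n - real m)) ^ t * real (num_tables n m)"
  using assms(1)
proof (induction t)
  case 0
  then show ?case by simp
next
  case (Suc t)
  let ?p = "m - Suc t"
  have p: "Suc ?p = m - t" using Suc.prems by simp
  have "(real n - real m) * num_tables n ?p \<le> real (n - Suc ?p) * num_tables n ?p"
    using assms p by (intro mult_right_mono) auto
  also have "\<dots> \<le> real (Suc ?p) * num_tables n (Suc ?p)"
    using num_tables_upper[of n ?p] by (metis of_nat_le_iff of_nat_mult)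
  also have "\<dots> \<le> real m * num_tables n (m - t)"
    unfolding p by (intro mult_right_mono) auto
  finally have "num_tables n ?p \<le> real m / (real n - real m) * num_tables n (m - t)"
    using assms(2) by (simp add: field_simps)
  also have "\<dots> \<le> real m / (real n - real m) *
      ((real m / (real n - real m)) ^ t * real (num_tables n m))"
    using Suc assms(2) by (intro mult_left_mono) auto
  finally show ?case by (simp add: mult.assoc)
qed

lemma num_tables_drop_lower:
  assumes "t \<le> m" "m < n"
  shows "(real (m - t) / (real n + real m)) ^ t * real (num_tables n m) \<le> real (num_tables n (m - t))"
proof -
  have "(real (m - t) / (real n + real m)) ^ i * real (num_tables n m) \<le> real (num_tables n (m - i))"
    if "i \<le> t" for i
    using that
  proof (induction i)
    case 0
    then show ?case by simp
  next
    case (Suc i)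
    let ?p = "m - Suc i"
    have p: "Suc ?p = m - i" using Suc.prems assms by simp
    have "real (m - t) * num_tables n (m - i) \<le> real (Suc ?p) * num_tables n (Suc ?p)"
      unfolding p using Suc.prems by (intro mult_right_mono) auto
    also have "\<dots> \<le> real (n + ?p) * num_tables n ?p"
      using num_tables_lower[of ?p n] by (metis of_nat_le_iff of_nat_mult)
    also have "\<dots> \<le> (real n + real m) * num_tables n ?p"
      by (intro mult_right_mono) auto
    finally have *: "real (m - t) / (real n + real m) * num_tables n (m - i) \<le> num_tables n ?p"
      using assms(2) by (simp add: field_simps)
    have "(real (m - t) / (real n + real m)) ^ Suc i * real (num_tables n m) =
       real (m - t) / (real n + real m) * ((real (m - t) / (real n + real m)) ^ i * real (num_tables n m))"
      by (simp add: mult.assoc)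
    also have "\<dots> \<le> real (m - t) / (real n + real m) * num_tables n (m - i)"
      using Suc by (intro mult_left_mono) auto
    finally show ?case using * by linarith
  qed
  then show ?thesis by simp
qed

section \<open>Occurrences of patterns and windows of the table\<close>

lemma subseq_indices:
  assumes "subseq xs ys"
  shows "\<exists>p. (\<forall>i<length xs. p i < length ys \<and> xs ! i = ys ! p i) \<and>
      (\<forall>i j. i < j \<longrightarrow> j < length xs \<longrightarrow> p i < p j)"
  using assms
proof induction
  case (list_emb_Cons xs ys y)
  then obtain p where "\<forall>i<length xs. p i < length ys \<and> xs ! i = ys ! p i"
    "\<forall>i j. i < j \<longrightarrow> j < length xs \<longrightarrow> p i < p j" by blast
  then show ?case by (intro exI[of _ "\<lambda>i. Suc (p i)"]) auto
next
  case (list_emb_Cons2 x y xs ys)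
  then obtain p where p: "\<forall>i<length xs. p i < length ys \<and> xs ! i = ys ! p i"
    "\<forall>i j. i < j \<longrightarrow> j < length xs \<longrightarrow> p i < p j" by blast
  show ?case
  proof (intro exI[of _ "\<lambda>i. case i of 0 \<Rightarrow> 0 | Suc i \<Rightarrow> Suc (p i)"] conjI allI impI)
    fix i j assume "i < j" "j < length (x # xs)"
    then show "(case i of 0 \<Rightarrow> 0 | Suc i \<Rightarrow> Suc (p i)) < (case j of 0 \<Rightarrow> 0 | Suc i \<Rightarrow> Suc (p i))"
      using p by (cases i; cases j) auto
  next
    fix i assume "i < length (x # xs)"
    then show "(case i of 0 \<Rightarrow> 0 | Suc i \<Rightarrow> Suc (p i)) < length (y # ys)"
      using p by (cases i) auto
  next
    fix i assume "i < length (x # xs)"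
    then show "(x # xs) ! i = (y # ys) ! (case i of 0 \<Rightarrow> 0 | Suc i \<Rightarrow> Suc (p i))"
      using p list_emb_Cons2 by (cases i) auto
  qed
qed simp

text \<open>
  Otherwise the first \<open>k\<close> entries are below the remaining ones, hence are exactly \<open>1, \<dots>, k\<close>.
\<close>

lemma crossing_inversion:
  assumes "indecomposable c" "1 \<le> k" "k < length c"
  shows "\<exists>u v. u < k \<and> k \<le> v \<and> v < length c \<and> c ! v < c ! u"
proof (rule ccontr)
  assume none: "\<not> ?thesis"
  have no: "c ! u \<le> c ! v" if "u < k" "k \<le> v" "v < length c" for u v
    using that none not_less by blast
  have set: "set c = {1..length c}" and dis: "distinct c"
    using assms(1) by (auto simp: indecomposable_def n_permutations_iff)
  let ?T = "set (take k c)"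
  have T: "card ?T = k" using dis assms(3) by (simp add: distinct_card)
  have sub: "?T \<subseteq> {1..length c}" using set set_take_subset[of k c] by blast
  have ne: "?T \<noteq> {}" using T assms(2) by auto
  define M where "M = Max ?T"
  have M: "M \<in> ?T" unfolding M_def using ne by (intro Max_in) auto
  have "?T = {1..M}"
  proof
    show "?T \<subseteq> {1..M}" using sub by (auto simp: M_def)
    show "{1..M} \<subseteq> ?T"
    proof
      fix x assume x: "x \<in> {1..M}"
      have "M \<le> length c" using M sub by auto
      then have "x \<in> set c" using x set by auto
      then obtain v where v: "v < length c" "c ! v = x" by (auto simp: in_set_conv_nth)
      show "x \<in> ?T"
      proof (cases "v < k")
        case True
        then show ?thesis using v assms(3) by (auto simp: in_set_conv_nth)
      next
        case False
        obtain u where u: "u < k" "c ! u = M" using M by (auto simp: in_set_conv_nth)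
        then have "M \<le> x" using no[of u v] False v by simp
        then have "x = M" using x by simp
        then show ?thesis using M by simp
      qed
    qed
  qed
  with T have "?T = {1..k}" by simp
  then have "decomposable c" using assms by (auto simp: decomposable_def)
  then show False using assms(1) by (simp add: indecomposable_def)
qed

text \<open>
  An occurrence of an indecomposable \<open>c\<close> makes the table heavy on a window of bounded length.
  If all gaps between consecutive positions of the occurrence are short, then the whole occurrence
  fits into the window, and its own inversions are counted there. If some gap is long, then an
  inversion \<open>\<sigma>(U) > \<sigma>(V)\<close> of the occurrence jumps across it, and every entry in between is
  smaller than \<open>\<sigma>(U)\<close> or larger than \<open>\<sigma>(V)\<close>: either many are larger, which makes the table large
  at \<open>V\<close>, or many are smaller, and each of them contributes just after \<open>U\<close>.
\<close>

lemma heavy_window_if_contains: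
  assumes "contains_pattern \<sigma> c" "indecomposable c"
  obtains a where "a < length \<sigma>"
    "inversions c \<le> sum (inv_table \<sigma>) {a..<a + length c * (2 * inversions c + 1)}"
proof -
  define r s L where "r = length c" and "s = inversions c" and "L = r * (2 * s + 1)"
  have r: "1 \<le> r" using assms(2) by (cases c) (auto simp: r_def indecomposable_def)
  then have L: "2 * s + 1 \<le> L" unfolding L_def by (cases r) auto
  obtain xs where xs: "subseq xs \<sigma>" "same_relative_order xs c"
    using assms(1) by (auto simp: contains_pattern_def)
  then have lx: "length xs = r" by (simp add: same_relative_order_def r_def)
  obtain p where p: "\<And>i. i < r \<Longrightarrow> p i < length \<sigma>" "\<And>i. i < r \<Longrightarrow> xs ! i = \<sigma> ! p i"
    and mono: "\<And>i j. i < j \<Longrightarrow> j < r \<Longrightarrow> p i < p j"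
    using subseq_indices[OF xs(1)] lx by metis
  have ord: "\<sigma> ! p i < \<sigma> ! p j \<longleftrightarrow> c ! i < c ! j" if "i < r" "j < r" for i j
    using xs(2) that p(2) lx by (simp add: same_relative_order_def)
  have mono': "p i \<le> p j" if "i \<le> j" "j < r" for i j
    using mono[of i j] that by (cases "i = j") auto
  have inj: "inj_on p {..<r}"
    by (rule inj_onI) (metis lessThan_iff linorder_neqE_nat mono order_less_irrefl)
  \<comment> \<open>the window length \<open>L\<close> covers the whole occurrence when all gaps are at most \<open>2 * s\<close>\<close>
  have "\<exists>a<length \<sigma>. s \<le> sum (inv_table \<sigma>) {a..<a + L}"
  proof (cases "\<forall>i. Suc i < r \<longrightarrow> p (Suc i) - p i \<le> 2 * s")
    case True
    have span: "p i \<le> p 0 + i * (2 * s)" if "i < r" for i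
      using that
    proof (induction i)
      case (Suc i)
      then have "p (Suc i) - p i \<le> 2 * s" "p i \<le> p 0 + i * (2 * s)" using True by auto
      then show ?case by simp
    qed simp
    have "s = sum (inv_table c) {..<r}"
      unfolding s_def r_def by (rule inversions_eq_sum_inv_table)
    also have "\<dots> \<le> (\<Sum>i<r. inv_table \<sigma> (p i))"
    proof (rule sum_mono)
      fix i assume "i \<in> {..<r}"
      then have i: "i < r" by simp
      have "card {i'. i' < i \<and> c ! i < c ! i'} = card (p ` {i'. i' < i \<and> c ! i < c ! i'})"
        by (rule card_image[symmetric]) (rule inj_on_subset[OF inj], use i in auto)
      also have "\<dots> \<le> card {i'. i' < p i \<and> \<sigma> ! p i < \<sigma> ! i'}"
        using i mono[OF _ i] ord[OF i] by (intro card_mono) auto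
      finally show "inv_table c i \<le> inv_table \<sigma> (p i)"
        using i p(1)[OF i] by (simp add: inv_table_def r_def)
    qed
    also have "\<dots> = sum (inv_table \<sigma>) (p ` {..<r})" by (simp add: sum.reindex[OF inj])
    also have "\<dots> \<le> sum (inv_table \<sigma>) {p 0..<p 0 + L}"
    proof (rule sum_mono2)
      show "p ` {..<r} \<subseteq> {p 0..<p 0 + L}"
      proof
        fix x assume "x \<in> p ` {..<r}"
        then obtain i where i: "i < r" "x = p i" by auto
        have "i * (2 * s) \<le> (r - 1) * (2 * s)" using i by (intro mult_right_mono) auto
        also have "\<dots> < L" unfolding L_def using r by (cases r) auto
        finally show "x \<in> {p 0..<p 0 + L}"
          using span[OF i(1)] mono'[of 0 i] i by auto
      qed
    qed auto
    finally show ?thesis using p(1)[of 0] r by (intro exI[of _ "p 0"]) auto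
  next
    case False
    then obtain i where i: "Suc i < r" "2 * s < p (Suc i) - p i" by (auto simp: not_le)
    \<comment> \<open>an inversion of the pattern jumps across the long gap\<close>
    obtain u v where uv: "u < Suc i" "Suc i \<le> v" "v < length c" "c ! v < c ! u"
      using crossing_inversion[OF assms(2), of "Suc i"] i unfolding r_def by auto
    have vr: "v < r" and ur: "u < r" using uv i by (auto simp: r_def)
    define U V where "U = p u" and "V = p v"
    have "U \<le> p i" "p (Suc i) \<le> V" unfolding U_def V_def using mono' uv i vr by auto
    then have gap: "U + 2 * s < V" using i by simp
    have VU: "\<sigma> ! V < \<sigma> ! U" using ord[OF vr ur] uv(4) by (simp add: U_def V_def)
    have lenU: "U < length \<sigma>" and lenV: "V < length \<sigma>"
      unfolding U_def V_def using p(1) ur vr by auto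
    show ?thesis
    proof (cases "s \<le> inv_table \<sigma> V")
      case True
      have "s \<le> inv_table \<sigma> V" using True .
      also have "\<dots> \<le> sum (inv_table \<sigma>) {V..<V + L}"
        using L by (intro member_le_sum) auto
      finally show ?thesis using lenV by blast
    next
      case False
      \<comment> \<open>of the \<open>2 * s\<close> positions after \<open>U\<close>, fewer than \<open>s\<close> carry an entry above \<open>\<sigma> ! V\<close>\<close>
      define H where "H = {w. U < w \<and> w \<le> U + 2 * s \<and> \<sigma> ! V < \<sigma> ! w}"
      define G where "G = {U<..U + 2 * s} - H"
      have "card H \<le> inv_table \<sigma> V"
        using gap lenV unfolding inv_table_def H_def by (auto intro!: card_mono)
      then have "s \<le> card G"
        using False unfolding G_def by (subst card_Diff_subset) (auto simp: H_def)
      also have "\<dots> = (\<Sum>w\<in>G. 1)" by simp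
      also have "\<dots> \<le> sum (inv_table \<sigma>) G"
      proof (rule sum_mono)
        fix w assume "w \<in> G"
        then have w: "U < w" "w \<le> U + 2 * s" "\<sigma> ! w \<le> \<sigma> ! V" by (auto simp: G_def H_def)
        then have "U \<in> {i. i < w \<and> \<sigma> ! w < \<sigma> ! i}" using VU by simp
        then have "card {i. i < w \<and> \<sigma> ! w < \<sigma> ! i} > 0" by (auto simp: card_gt_0_iff)
        then show "1 \<le> inv_table \<sigma> w" using w gap lenV by (simp add: inv_table_def)
      qed
      also have "\<dots> \<le> sum (inv_table \<sigma>) {U..<U + L}"
        using L by (intro sum_mono2) (auto simp: G_def)
      finally show ?thesis using lenU by blast
    qed
  qed
  then show ?thesis using that by (auto simp: L_def r_def s_def)
qed

lemma same_relative_order_append: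
  assumes "same_relative_order xs ys" "same_relative_order xs' ys'"
    and "\<And>x x'. x \<in> set xs \<Longrightarrow> x' \<in> set xs' \<Longrightarrow> x < x'"
    and "\<And>y y'. y \<in> set ys \<Longrightarrow> y' \<in> set ys' \<Longrightarrow> y < y'"
  shows "same_relative_order (xs @ xs') (ys @ ys')"
proof -
  have len: "length xs = length ys" "length xs' = length ys'"
    using assms by (auto simp: same_relative_order_def)
  have "(xs @ xs') ! i < (xs @ xs') ! j \<longleftrightarrow> (ys @ ys') ! i < (ys @ ys') ! j"
    if ij: "i < length xs + length xs'" "j < length xs + length xs'" for i j
  proof -
    consider "i < length xs" "j < length xs" | "i < length xs" "length xs \<le> j"
      | "length xs \<le> i" "j < length xs" | "length xs \<le> i" "length xs \<le> j" by linarith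
    then show ?thesis
    proof cases
      case 1
      then show ?thesis using assms(1) len by (simp add: nth_append same_relative_order_def)
    next
      case 2
      then show ?thesis using assms(3,4) len ij by (simp add: nth_append)
    next
      case 3
      then have "xs ! j < xs' ! (i - length xs)" "ys ! j < ys' ! (i - length xs)"
        using assms(3,4) len ij by auto
      then show ?thesis using 3 len by (simp add: nth_append)
    next
      case 4
      then have "i - length xs < length xs'" "j - length xs < length xs'" using ij by auto
      then show ?thesis using 4 assms(2) len by (simp add: nth_append same_relative_order_def)
    qed
  qed
  then show ?thesis using len by (simp add: same_relative_order_def)
qed

lemma foldr_direct_sum_pos:
  "(\<And>c. c \<in> set cs \<Longrightarrow> set c = {1..length c}) \<Longrightarrow> x \<in> set (foldr direct_sum cs []) \<Longrightarrow> 0 < x"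
proof (induction cs arbitrary: x)
  case (Cons c cs)
  have c: "set c = {1..length c}" using Cons.prems(1)[of c] by simp
  show ?case
  proof (cases "x \<in> set c")
    case True
    then show ?thesis by (simp add: c)
  next
    case False
    then obtain y where "y \<in> set (foldr direct_sum cs [])" "x = length c + y"
      using Cons.prems(2) by (auto simp: direct_sum_def[of c])
    then show ?thesis using Cons.IH[of y] Cons.prems(1) by simp
  qed
qed simp

text \<open>
  By \<open>window_order\<close> each window realises its component above all that precedes it, so that
  disjoint windows taken from left to right form the direct sum. The induction carries the position
  \<open>a\<close> from which on the entries are selected.
\<close>

lemma contains_if_windows:
  assumes dis: "distinct \<sigma>"
    and perms: "\<And>c. c \<in> set cs \<Longrightarrow> distinct c \<and> set c = {1..length c}"
    and fits: "\<And>i. i < length cs \<Longrightarrow> b i + length (cs ! i) \<le> length \<sigma>"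
    and disj: "\<And>i. Suc i < length cs \<Longrightarrow> b i + length (cs ! i) \<le> b (Suc i)"
    and match: "\<And>i j. i < length cs \<Longrightarrow> j < length (cs ! i) \<Longrightarrow>
      inv_table \<sigma> (b i + j) = inv_table (cs ! i) j"
  shows "contains_pattern \<sigma> (foldr direct_sum cs [])"
proof -
  have "\<exists>xs. subseq xs (drop a \<sigma>) \<and> same_relative_order xs (foldr direct_sum cs []) \<and>
      (\<forall>x\<in>set xs. \<forall>i<a. \<sigma> ! i < x)"
    if "cs \<noteq> [] \<Longrightarrow> a \<le> b 0" for a
    using that perms fits disj match
  proof (induction cs arbitrary: a b)
    case Nil
    show ?case by (intro exI[of _ "[]"]) (auto simp: same_relative_order_def)
  next
    case (Cons c cs)
    define l where "l = b 0 + length c"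
    have c: "distinct c" "set c = {1..length c}" using Cons.prems(2) by auto
    have ab: "a \<le> b 0" and bl: "l \<le> length \<sigma>"
      using Cons.prems(1) Cons.prems(3)[of 0] by (auto simp: l_def)
    have win: "(\<forall>i<b 0. \<forall>j<length c. \<sigma> ! i < \<sigma> ! (b 0 + j)) \<and>
       (\<forall>i<length c. \<forall>j<length c. \<sigma> ! (b 0 + i) < \<sigma> ! (b 0 + j) \<longleftrightarrow> c ! i < c ! j)"
      using Cons.prems(5)[of 0] bl
      by (intro window_order[OF dis c(1)]) (auto simp: l_def)
    have "\<exists>ys. subseq ys (drop l \<sigma>) \<and> same_relative_order ys (foldr direct_sum cs []) \<and>
      (\<forall>x\<in>set ys. \<forall>i<l. \<sigma> ! i < x)"
    proof (rule Cons.IH[where b = "\<lambda>i. b (Suc i)"])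
      show "l \<le> b (Suc 0)" if "cs \<noteq> []" using Cons.prems(4)[of 0] that by (simp add: l_def)
      show "distinct d \<and> set d = {1..length d}" if "d \<in> set cs" for d
        using Cons.prems(2) that by simp
      show "b (Suc i) + length (cs ! i) \<le> length \<sigma>" if "i < length cs" for i
        using Cons.prems(3)[of "Suc i"] that by simp
      show "b (Suc i) + length (cs ! i) \<le> b (Suc (Suc i))" if "Suc i < length cs" for i
        using Cons.prems(4)[of "Suc i"] that by simp
      show "inv_table \<sigma> (b (Suc i) + j) = inv_table (cs ! i) j"
        if "i < length cs" "j < length (cs ! i)" for i j
        using Cons.prems(5)[of "Suc i"] that by simp
    qed
    then obtain ys where ys: "subseq ys (drop l \<sigma>)"
      "same_relative_order ys (foldr direct_sum cs [])" "\<And>x i. x \<in> set ys \<Longrightarrow> i < l \<Longrightarrow> \<sigma> ! i < x"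
      by blast
    define w where "w = take (length c) (drop (b 0) \<sigma>)"
    have lw: "length w = length c" using bl by (simp add: w_def l_def)
    have w_nth: "w ! j = \<sigma> ! (b 0 + j)" if "j < length c" for j
      using that bl by (simp add: w_def l_def)
    have "drop a \<sigma> = drop a (take (b 0) \<sigma>) @ drop (b 0) \<sigma>"
      using ab bl by (metis append_take_drop_id drop_append diff_is_0_eq' drop_0 l_def le_add1
        length_take min.absorb2 order_trans)
    also have "drop (b 0) \<sigma> = w @ drop l \<sigma>"
      by (simp add: w_def l_def add.commute flip: drop_drop)
    finally have "subseq (w @ ys) (drop a \<sigma>)"
      using ys(1) by (metis list_emb_append_mono subseq_order.order_refl subseq_drop_many)
    moreover have "same_relative_order (w @ ys) (foldr direct_sum (c # cs) [])"
      proof -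
      have "same_relative_order w c"
        using win lw by (simp add: same_relative_order_def w_nth)
      moreover have "same_relative_order ys (map (\<lambda>x. length c + x) (foldr direct_sum cs []))"
        using ys(2) by (simp add: same_relative_order_def)
      moreover have "x < x'" if "x \<in> set w" "x' \<in> set ys" for x x'
        using that lw ys(3)[of x'] by (auto simp: in_set_conv_nth w_nth l_def)
      moreover have "y < y'" if "y \<in> set c" "y' \<in> set (map (\<lambda>x. length c + x) (foldr direct_sum cs []))" for y y'
        using that c(2) foldr_direct_sum_pos[of cs] Cons.prems(2) by force
      ultimately show ?thesis
        unfolding foldr.simps comp_def direct_sum_def by (rule same_relative_order_append)
    qed
    moreover have "\<sigma> ! i < x" if "x \<in> set (w @ ys)" "i < a" for x i
    proof (cases "x \<in> set ys")
      case True
      then show ?thesis using ys(3) that ab by (auto simp: l_def)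
    next
      case False
      then have "x \<in> set w" using that by auto
      then show ?thesis using win that ab lw by (auto simp: in_set_conv_nth w_nth)
    qed
    ultimately show ?case by blast
  qed
  from this[of 0] show ?thesis by (auto simp: contains_pattern_def)
qed

lemma contains_component:
  assumes "contains_pattern \<sigma> (foldr direct_sum cs [])" "c \<in> set cs"
  shows "contains_pattern \<sigma> c"
proof -
  obtain as bs where cs: "cs = as @ c # bs" using assms(2) by (meson split_list)
  define A B where "A = foldr direct_sum as []" and "B = foldr direct_sum bs []"
  have \<pi>: "foldr direct_sum cs [] = A @ map (\<lambda>x. length A + x) (c @ map (\<lambda>x. length c + x) B)"
    using foldr_direct_sum_append[of as "c # bs"]
    by (simp add: cs direct_sum_def A_def B_def)
  obtain xs where xs: "subseq xs \<sigma>" "same_relative_order xs (foldr direct_sum cs [])"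
    using assms(1) by (auto simp: contains_pattern_def)
  let ?ys = "take (length c) (drop (length A) xs)"
  have "subseq ?ys xs"
    by (meson subseq_order.order_trans sublist_drop sublist_imp_subseq sublist_take)
  then have "subseq ?ys \<sigma>" using xs(1) by (rule subseq_order.order_trans)
  moreover have "same_relative_order ?ys c"
  proof -
    have len: "length xs = length A + (length c + length B)"
      using xs(2) by (simp add: same_relative_order_def \<pi>)
    have "xs ! (length A + i) < xs ! (length A + j) \<longleftrightarrow> c ! i < c ! j"
      if "i < length c" "j < length c" for i j
    proof -
      have "xs ! (length A + i) < xs ! (length A + j) \<longleftrightarrow>
        foldr direct_sum cs [] ! (length A + i) < foldr direct_sum cs [] ! (length A + j)"
        using xs(2) that len by (simp add: same_relative_order_def)
      also have "\<dots> \<longleftrightarrow> c ! i < c ! j" using that by (simp add: \<pi> nth_append)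
      finally show ?thesis .
    qed
    then show ?thesis using len by (simp add: same_relative_order_def)
  qed
  ultimately show ?thesis by (auto simp: contains_pattern_def)
qed

lemma complement_in_n_permutations:
  assumes "\<sigma> \<in> n_permutations n"
  shows "complement_perm \<sigma> \<in> n_permutations n"
proof -
  have len: "length \<sigma> = n" using assms by (rule n_permutations_length)
  have set: "set \<sigma> = {1..n}" "distinct \<sigma>" using assms by (auto simp: n_permutations_iff)
  have "(\<lambda>x. n + 1 - x) ` {1..n} = {1..n}"
  proof
    show "{1..n} \<subseteq> (\<lambda>x. n + 1 - x) ` {1..n}"
    proof
      fix x assume "x \<in> {1..n}"
      then have "x = n + 1 - (n + 1 - x)" "n + 1 - x \<in> {1..n}" by auto
      then show "x \<in> (\<lambda>x. n + 1 - x) ` {1..n}" by (rule image_eqI)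
    qed
  qed auto
  then show ?thesis
    using set by (auto simp: n_permutations_iff complement_perm_def len distinct_map inj_on_def)
qed

lemma complement_complement:
  assumes "\<sigma> \<in> n_permutations n"
  shows "complement_perm (complement_perm \<sigma>) = \<sigma>"
proof (rule nth_equalityI)
  fix i assume "i < length (complement_perm (complement_perm \<sigma>))"
  then have "i < length \<sigma>" by (simp add: complement_perm_def)
  then show "complement_perm (complement_perm \<sigma>) ! i = \<sigma> ! i"
    using n_permutations_nth[OF assms, of i] n_permutations_length[OF assms]
    by (simp add: complement_perm_def)
qed (simp add: complement_perm_def)

text \<open>
  Each pair of positions is an inversion of exactly one of the two permutations.
\<close>

lemma inversions_complement:
  assumes "\<sigma> \<in> n_permutations n"
  shows "inversions \<sigma> + inversions (complement_perm \<sigma>) = n choose 2"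
proof -
  have len: "length \<sigma> = n" using assms by (rule n_permutations_length)
  have le: "\<sigma> ! i \<le> n" if "i < n" for i
    using n_permutations_nth[OF assms that] by simp
  have split: "inv_table \<sigma> j + inv_table (complement_perm \<sigma>) j = j" if j: "j < n" for j
  proof -
    have "{i. i < j \<and> complement_perm \<sigma> ! j < complement_perm \<sigma> ! i} = {i. i < j \<and> \<sigma> ! i < \<sigma> ! j}"
    proof -
      have "n + 1 - \<sigma> ! j < n + 1 - \<sigma> ! i \<longleftrightarrow> \<sigma> ! i < \<sigma> ! j" if "i < j" for i
        using le[OF j] le[of i] that j by linarith
      then show ?thesis using j by (auto simp: complement_perm_def len)
    qed
    then have "inv_table \<sigma> j + inv_table (complement_perm \<sigma>) j
       = card {i. i < j \<and> \<sigma> ! j < \<sigma> ! i} + card {i. i < j \<and> \<sigma> ! i < \<sigma> ! j}"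
      using j len by (simp add: inv_table_def complement_perm_def)
    also have "\<dots> = card ({i. i < j \<and> \<sigma> ! j < \<sigma> ! i} \<union> {i. i < j \<and> \<sigma> ! i < \<sigma> ! j})"
      by (rule card_Un_disjoint[symmetric]) auto
    also have "{i. i < j \<and> \<sigma> ! j < \<sigma> ! i} \<union> {i. i < j \<and> \<sigma> ! i < \<sigma> ! j} = {..<j}"
    proof -
      have "\<sigma> ! i \<noteq> \<sigma> ! j" if "i < j" for i
        using assms that j len by (auto simp: n_permutations_iff nth_eq_iff_index_eq)
      then show ?thesis by (auto simp: neq_iff)
    qed
    finally show ?thesis by simp
  qed
  have "inversions \<sigma> + inversions (complement_perm \<sigma>) = (\<Sum>j<n. inv_table \<sigma> j + inv_table (complement_perm \<sigma>) j)"
    using len by (simp add: inversions_eq_sum_inv_table sum.distrib complement_perm_def)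
  also have "\<dots> = (\<Sum>j<n. j)" using split by simp
  also have "\<dots> = n choose 2"
    by (induction n) (simp_all add: numeral_2_eq_2)
  finally show ?thesis .
qed

lemma contains_complement:
  assumes \<sigma>: "\<sigma> \<in> n_permutations n" and \<pi>: "\<pi> \<in> n_permutations k" and con: "contains_pattern \<sigma> \<pi>"
  shows "contains_pattern (complement_perm \<sigma>) (complement_perm \<pi>)"
proof -
  obtain xs where xs: "subseq xs \<sigma>" "same_relative_order xs \<pi>"
    using con by (auto simp: contains_pattern_def)
  have len: "length \<sigma> = n" "length \<pi> = k" "length xs = k"
    using \<sigma> \<pi> xs(2) n_permutations_length by (auto simp: same_relative_order_def)
  obtain p where p: "\<forall>i<length xs. p i < length \<sigma> \<and> xs ! i = \<sigma> ! p i"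
    using subseq_indices[OF xs(1)] by auto
  have lex: "xs ! i \<le> n" if "i < k" for i
    using p that n_permutations_nth(2)[OF \<sigma>, of "p i"] len by simp
  have lep: "\<pi> ! i \<le> k" if "i < k" for i
    using n_permutations_nth[OF \<pi> that] by simp
  have flip: "N + 1 - x < N + 1 - y \<longleftrightarrow> y < x" if "x \<le> N" "y \<le> N" for N x y :: nat
    using that by auto
  have "subseq (map (\<lambda>x. n + 1 - x) xs) (complement_perm \<sigma>)"
    unfolding complement_perm_def len by (rule subseq_map[OF xs(1)])
  moreover have "same_relative_order (map (\<lambda>x. n + 1 - x) xs) (complement_perm \<pi>)"
    unfolding same_relative_order_def
  proof (intro conjI allI impI)
    fix i j
    assume "i < length (map (\<lambda>x. n + 1 - x) xs)" "j < length (map (\<lambda>x. n + 1 - x) xs)"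
    then have ij: "i < k" "j < k" by (simp_all add: len)
    have "map (\<lambda>x. n + 1 - x) xs ! i < map (\<lambda>x. n + 1 - x) xs ! j \<longleftrightarrow> xs ! j < xs ! i"
      using ij flip[OF lex lex] by (simp add: len)
    also have "\<dots> \<longleftrightarrow> \<pi> ! j < \<pi> ! i"
      using xs(2) ij len by (simp add: same_relative_order_def)
    also have "\<dots> \<longleftrightarrow> complement_perm \<pi> ! i < complement_perm \<pi> ! j"
      using ij flip[OF lep lep] by (simp add: complement_perm_def len)
    finally show "map (\<lambda>x. n + 1 - x) xs ! i < map (\<lambda>x. n + 1 - x) xs ! j \<longleftrightarrow>
      complement_perm \<pi> ! i < complement_perm \<pi> ! j" .
  qed (simp add: len complement_perm_def)
  ultimately show ?thesis by (auto simp: contains_pattern_def)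
qed

section \<open>Tables with a prescribed window\<close>

text \<open>
  The second moment method in counting form: Cauchy-Schwarz applied to the number of sets that
  contain a given point, against the indicator of the union.
\<close>

lemma second_moment_union:
  fixes A :: "'i \<Rightarrow> 'a set" and \<alpha> \<beta> \<gamma> :: real
  assumes I: "finite I" and S: "finite S" and A: "\<And>i. i \<in> I \<Longrightarrow> A i \<subseteq> S"
    and low: "\<And>i. i \<in> I \<Longrightarrow> \<alpha> \<le> card (A i)" and up: "\<And>i. i \<in> I \<Longrightarrow> card (A i) \<le> \<beta>"
    and pair: "\<And>i j. i \<in> I \<Longrightarrow> j \<in> I \<Longrightarrow> i \<noteq> j \<Longrightarrow> card (A i \<inter> A j) \<le> \<gamma>"
    and \<alpha>: "0 \<le> \<alpha>" and \<gamma>: "0 \<le> \<gamma>"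
  shows "(real (card I) * \<alpha>)\<^sup>2 \<le>
    real (card (\<Union>i\<in>I. A i)) * (real (card I) * \<beta> + (real (card I))\<^sup>2 * \<gamma>)"
proof -
  define U where "U = (\<Union>i\<in>I. A i)"
  define X :: "'a \<Rightarrow> real" where "X e = (\<Sum>i\<in>I. indicator (A i) e)" for e
  have U: "finite U" unfolding U_def using A S by (meson UN_least finite_subset)
  have AU: "A i \<subseteq> U" if "i \<in> I" for i using that by (auto simp: U_def)
  have mom: "(\<Sum>e\<in>U. indicator B e) = real (card B)" if "B \<subseteq> U" for B
  proof -
    have "(\<Sum>e\<in>U. indicator B e) = (\<Sum>e\<in>B. (1 :: real))"
      using that U by (intro sum.mono_neutral_cong_right) (auto simp: indicator_def)
    then show ?thesis by simp
  qed
  have "real (card I) * \<alpha> = (\<Sum>i\<in>I. \<alpha>)" by simp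
  also have "\<dots> \<le> (\<Sum>i\<in>I. real (card (A i)))" using low by (intro sum_mono)
  also have "\<dots> = (\<Sum>i\<in>I. \<Sum>e\<in>U. indicator (A i) e)"
    by (rule sum.cong) (simp_all add: mom[OF AU])
  also have "\<dots> = (\<Sum>e\<in>U. X e)" unfolding X_def by (rule sum.swap)
  finally have first: "real (card I) * \<alpha> \<le> (\<Sum>e\<in>U. X e)" .
  have "(\<Sum>e\<in>U. (X e)\<^sup>2) = (\<Sum>e\<in>U. \<Sum>i\<in>I. \<Sum>j\<in>I. indicator (A i \<inter> A j) e)"
    unfolding X_def power2_eq_square sum_product indicator_inter_arith ..
  also have "\<dots> = (\<Sum>i\<in>I. \<Sum>e\<in>U. \<Sum>j\<in>I. indicator (A i \<inter> A j) e)" by (rule sum.swap)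
  also have "\<dots> = (\<Sum>i\<in>I. \<Sum>j\<in>I. \<Sum>e\<in>U. indicator (A i \<inter> A j) e)"
    by (rule sum.cong[OF refl sum.swap])
  also have "\<dots> = (\<Sum>i\<in>I. \<Sum>j\<in>I. real (card (A i \<inter> A j)))"
    by (intro sum.cong refl mom) (use AU in blast)
  also have "\<dots> \<le> (\<Sum>i\<in>I. \<Sum>j\<in>I. (if i = j then \<beta> else 0) + \<gamma>)"
  proof (intro sum_mono)
    fix i j assume ij: "i \<in> I" "j \<in> I"
    show "real (card (A i \<inter> A j)) \<le> (if i = j then \<beta> else 0) + \<gamma>"
    proof (cases "i = j")
      case True
      then show ?thesis using up[OF ij(1)] \<gamma> by simp
    next
      case False
      then show ?thesis using pair[OF ij] by simp
    qed
  qed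
  also have "\<dots> = real (card I) * \<beta> + (real (card I))\<^sup>2 * \<gamma>"
    using I by (simp add: sum.distrib power2_eq_square algebra_simps)
  finally have second: "(\<Sum>e\<in>U. (X e)\<^sup>2) \<le> real (card I) * \<beta> + (real (card I))\<^sup>2 * \<gamma>" .
  have "(real (card I) * \<alpha>)\<^sup>2 \<le> (\<Sum>e\<in>U. X e * 1)\<^sup>2"
    using first \<alpha> by (intro power_mono) simp_all
  also have "\<dots> \<le> (\<Sum>e\<in>U. (X e)\<^sup>2) * (\<Sum>e\<in>U. 1\<^sup>2)" by (rule Cauchy_Schwarz_ineq_sum)
  also have "\<dots> = real (card U) * (\<Sum>e\<in>U. (X e)\<^sup>2)" by simp
  also have "\<dots> \<le> real (card U) * (real (card I) * \<beta> + (real (card I))\<^sup>2 * \<gamma>)"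
    using second by (intro mult_left_mono) auto
  finally show ?thesis unfolding U_def .
qed

lemma exists_minorant_with_sum:
  fixes e :: "'a \<Rightarrow> nat"
  assumes "finite A" "s \<le> sum e A"
  shows "\<exists>f. (\<forall>j. f j \<le> e j) \<and> (\<forall>j. j \<notin> A \<longrightarrow> f j = 0) \<and> sum f A = s"
  using assms(2)
proof (induction s)
  case 0
  show ?case by (intro exI[of _ "\<lambda>_. 0"]) auto
next
  case (Suc s)
  then obtain f where f: "\<forall>j. f j \<le> e j" "\<forall>j. j \<notin> A \<longrightarrow> f j = 0" "sum f A = s" by auto
  have "\<exists>i\<in>A. f i < e i"
  proof (rule ccontr)
    assume "\<not> ?thesis"
    then have "sum e A \<le> sum f A" by (intro sum_mono) (auto simp: not_less)
    then show False using Suc.prems f(3) by linarith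
  qed
  then obtain i where i: "i \<in> A" "f i < e i" by blast
  have "sum (f(i := Suc (f i))) A = Suc s"
    using f(3) i(1) assms(1) by (simp add: sum.remove[of A i])
  moreover have "(f(i := Suc (f i))) j \<le> e j" for j using f(1) i(2) by simp
  moreover have "\<forall>j. j \<notin> A \<longrightarrow> (f(i := Suc (f i))) j = 0" using f(2) i(1) by auto
  ultimately show ?case by blast
qed

lemma card_dominating_bound:
  assumes "sum f {..<n} = t" "m < n"
  shows "real (card {e \<in> inv_tables n m. \<forall>j. f j \<le> e j})
    \<le> (real m / (real n - real m)) ^ t * real (num_tables n m)"
proof (cases "t \<le> m")
  case True
  then show ?thesis
    using card_dominating_le[OF assms(1), of m] num_tables_drop_upper[OF True assms(2)] by simp
next
  case False
  then show ?thesis using card_dominating_le[OF assms(1), of m] assms(2) by simp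
qed

text \<open>
  A table that is heavy on a window dominates a function of sum \<open>s\<close> supported there. There are
  boundedly many such functions per window, and each is dominated by few tables.
\<close>

lemma card_heavy_window:
  assumes "m < n"
  shows "real (card {e \<in> inv_tables n m. \<exists>a<n. s \<le> sum e {a..<a + L}})
    \<le> real n * real (Suc s ^ L) * (real m / (real n - real m)) ^ s * real (num_tables n m)"
proof -
  let ?u = "(real m / (real n - real m)) ^ s * real (num_tables n m)"
  define G :: "nat \<Rightarrow> (nat \<Rightarrow> nat) set" where "G a = PiE_dflt {a..<a + L} 0 (\<lambda>_. {..s})" for a
  define G' where "G' a = {f \<in> G a. sum f {..<n} = s}" for a
  define D where "D f = {e \<in> inv_tables n m. \<forall>j. f j \<le> e j}" for f :: "nat \<Rightarrow> nat"
  have finG: "finite (G a)" for a unfolding G_def by (rule finite_PiE_dflt) auto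
  have cardG: "card (G a) = Suc s ^ L" for a unfolding G_def by (subst card_PiE_dflt) auto
  have finD: "finite (D f)" for f unfolding D_def by (simp add: finite_inv_tables)
  have sub: "{e \<in> inv_tables n m. \<exists>a<n. s \<le> sum e {a..<a + L}} \<subseteq> (\<Union>a<n. \<Union>f\<in>G' a. D f)"
  proof
    fix e assume "e \<in> {e \<in> inv_tables n m. \<exists>a<n. s \<le> sum e {a..<a + L}}"
    then obtain a where e: "e \<in> inv_tables n m" and a: "a < n" "s \<le> sum e {a..<a + L}" by auto
    obtain f where f: "\<forall>j. f j \<le> e j" "\<forall>j. j \<notin> {a..<a + L} \<longrightarrow> f j = 0" "sum f {a..<a + L} = s"
      using exists_minorant_with_sum[OF _ a(2)] by auto
    have "f j \<le> s" if "j \<in> {a..<a + L}" for j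
      using member_le_sum[of j "{a..<a + L}" f] that f(3) by simp
    then have "f \<in> G a" using f(2) by (auto simp: G_def PiE_dflt_def)
    \<comment> \<open>a window may reach beyond \<open>n\<close>, where tables vanish\<close>
    moreover have "sum f {..<n} = sum f ({..<n} \<inter> {a..<a + L})"
      using f(2) by (intro sum.mono_neutral_right) auto
    moreover have "\<dots> = sum f {a..<a + L}"
    proof (rule sum.mono_neutral_left)
      show "\<forall>i\<in>{a..<a + L} - {..<n} \<inter> {a..<a + L}. f i = 0"
        using f(1) inv_tablesD(2)[OF e] by (metis DiffE IntI le_zero_eq lessThan_iff not_le)
    qed auto
    ultimately have "f \<in> G' a" using f(3) by (simp add: G'_def)
    then show "e \<in> (\<Union>a<n. \<Union>f\<in>G' a. D f)" using a(1) e f(1) by (auto simp: D_def)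
  qed
  have finG': "finite (G' a)" for a using finG by (simp add: G'_def)
  have "real (card {e \<in> inv_tables n m. \<exists>a<n. s \<le> sum e {a..<a + L}})
      \<le> real (card (\<Union>a<n. \<Union>f\<in>G' a. D f))"
    using sub finG' finD by (intro of_nat_mono card_mono) auto
  also have "\<dots> \<le> real (\<Sum>a<n. card (\<Union>f\<in>G' a. D f))"
    by (intro of_nat_mono card_UN_le) auto
  also have "\<dots> \<le> real (\<Sum>a<n. \<Sum>f\<in>G' a. card (D f))"
    using finG' by (intro of_nat_mono sum_mono card_UN_le)
  also have "\<dots> = (\<Sum>a<n. \<Sum>f\<in>G' a. real (card (D f)))" by simp
  also have "\<dots> \<le> (\<Sum>a<n. \<Sum>f\<in>G' a. ?u)"
    unfolding D_def G'_def by (intro sum_mono card_dominating_bound assms) auto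
  also have "\<dots> \<le> (\<Sum>a<n. \<Sum>f\<in>G a. ?u)"
    using finG assms by (intro sum_mono sum_mono2) (auto simp: G'_def)
  also have "\<dots> = real n * real (Suc s ^ L) * ?u" by (simp add: cardG)
  finally show ?thesis by (simp add: mult.assoc)
qed

definition shifted :: "nat \<Rightarrow> (nat \<Rightarrow> nat) \<Rightarrow> nat \<Rightarrow> nat" where
  "shifted a w j = (if a \<le> j then w (j - a) else 0)"

lemma sum_shifted:
  assumes "\<forall>i\<ge>r. w i = 0" "a + r \<le> n"
  shows "sum (shifted a w) {..<n} = sum w {..<r}"
proof -
  have "sum (shifted a w) {..<n} = sum (shifted a w) {a..<a + r}"
    using assms by (intro sum.mono_neutral_right) (auto simp: shifted_def)
  also have "\<dots> = sum (\<lambda>i. shifted a w (i + a)) {0..<r}"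
    using sum.shift_bounds_nat_ivl[of "shifted a w" 0 a r] by (simp add: add.commute)
  also have "\<dots> = sum w {..<r}" by (simp add: shifted_def lessThan_atLeast0)
  finally show ?thesis .
qed

definition matches :: "nat \<Rightarrow> nat \<Rightarrow> nat \<Rightarrow> (nat \<Rightarrow> nat) \<Rightarrow> nat \<Rightarrow> (nat \<Rightarrow> nat) set" where
  "matches n m r w a = {e \<in> inv_tables n m. \<forall>i<r. e (a + i) = w i}"

lemma matches_dominates:
  assumes "\<forall>i\<ge>r. w i = 0" "e \<in> matches n m r w a"
  shows "shifted a w j \<le> e j"
proof (cases "a \<le> j \<and> j - a < r")
  case True
  then have "e (a + (j - a)) = w (j - a)" using assms(2) by (auto simp: matches_def)
  then show ?thesis using True by (simp add: shifted_def)
next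
  case False
  then show ?thesis using assms(1) by (auto simp: shifted_def)
qed

lemma card_matches_le:
  assumes w: "\<forall>i\<ge>r. w i = 0" and t: "sum w {..<r} = t" and "a + r \<le> n" "m < n"
  shows "real (card (matches n m r w a)) \<le> (real m / (real n - real m)) ^ t * real (num_tables n m)"
proof -
  have "card (matches n m r w a) \<le> card {e \<in> inv_tables n m. \<forall>j. shifted a w j \<le> e j}"
    using matches_dominates[OF w] by (intro card_mono) (auto simp: finite_inv_tables matches_def)
  then show ?thesis
    using card_dominating_bound[OF _ assms(4), of "shifted a w" t] sum_shifted[OF w assms(3)] t
    by fastforce
qed

lemma card_matches_Int_le:
  assumes w: "\<forall>i\<ge>r. w i = 0" and t: "sum w {..<r} = t"
    and "a + r \<le> b" "b + r \<le> n" "m < n"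
  shows "real (card (matches n m r w a \<inter> matches n m r w b))
    \<le> (real m / (real n - real m)) ^ (2 * t) * real (num_tables n m)"
proof -
  let ?f = "\<lambda>j. shifted a w j + shifted b w j"
  have "?f j \<le> e j" if "e \<in> matches n m r w a \<inter> matches n m r w b" for e j
  proof (cases "b \<le> j")
    case True
    then have "shifted a w j = 0" using w assms(3) by (simp add: shifted_def)
    then show ?thesis using that matches_dominates[OF w, of e n m b j] by simp
  next
    case False
    then have "shifted b w j = 0" by (simp add: shifted_def)
    then show ?thesis using that matches_dominates[OF w, of e n m a j] by simp
  qed
  then have "card (matches n m r w a \<inter> matches n m r w b) \<le> card {e \<in> inv_tables n m. \<forall>j. ?f j \<le> e j}"
    by (intro card_mono) (auto simp: finite_inv_tables matches_def)
  moreover have "sum ?f {..<n} = 2 * t"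
    using sum_shifted[OF w, of a n] sum_shifted[OF w, of b n] assms t by (simp add: sum.distrib)
  ultimately show ?thesis
    using card_dominating_bound[of ?f n "2 * t" m] assms(5) by fastforce
qed

text \<open>
  Tables that merely dominate the pattern on the window are easy to count; those that dominate
  it without matching it carry an additional inversion and are fewer by a factor of order
  \<open>m / n\<close>.
\<close>

lemma card_matches_ge:
  assumes w: "\<forall>i\<ge>r. w i = 0" and t: "sum w {..<r} = t"
    and a: "m \<le> a" "a + r \<le> n" and m: "t \<le> m" "m < n"
  shows "((real (m - t) / (real n + real m)) ^ t - real r * (real m / (real n - real m)) ^ Suc t)
      * real (num_tables n m) \<le> real (card (matches n m r w a))"
proof -
  let ?f = "shifted a w"
  define D where "D f = {e \<in> inv_tables n m. \<forall>j. f j \<le> e j}" for f :: "nat \<Rightarrow> nat"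
  define g where "g i = ?f(a + i := Suc (w i))" for i
  have finD: "finite (D f)" for f by (simp add: D_def finite_inv_tables)
  have sumf: "sum ?f {..<n} = t" using sum_shifted[OF w a(2)] t by simp
  have sumg: "sum (g i) {..<n} = Suc t" if "i < r" for i
  proof -
    have "a + i < n" using that a by simp
    moreover have "?f (a + i) = w i" by (simp add: shifted_def)
    ultimately show ?thesis
      using sumf by (simp add: g_def sum.remove[of "{..<n}" "a + i"])
  qed
  \<comment> \<open>a table above the window that does not match it exceeds it strictly at some place\<close>
  have "D ?f \<subseteq> matches n m r w a \<union> (\<Union>i<r. D (g i))"
  proof
    fix e assume e: "e \<in> D ?f"
    show "e \<in> matches n m r w a \<union> (\<Union>i<r. D (g i))"
    proof (cases "\<forall>i<r. e (a + i) = w i")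
      case True
      then show ?thesis using e by (simp add: D_def matches_def)
    next
      case False
      then obtain i where i: "i < r" "e (a + i) \<noteq> w i" by blast
      have "?f (a + i) \<le> e (a + i)" using e by (simp add: D_def)
      then have "Suc (w i) \<le> e (a + i)" using i(2) by (simp add: shifted_def)
      then have "e \<in> D (g i)" using e by (simp add: D_def g_def)
      then show ?thesis using i(1) by blast
    qed
  qed
  then have "card (D ?f) \<le> card (matches n m r w a \<union> (\<Union>i<r. D (g i)))"
    using finD by (intro card_mono) (auto simp: matches_def finite_inv_tables)
  also have "\<dots> \<le> card (matches n m r w a) + card (\<Union>i<r. D (g i))" by (rule card_Un_le)
  also have "\<dots> \<le> card (matches n m r w a) + (\<Sum>i<r. card (D (g i)))"
    by (intro add_left_mono card_UN_le) auto
  finally have "real (card (D ?f)) \<le> real (card (matches n m r w a)) + (\<Sum>i<r. real (card (D (g i))))"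
    using of_nat_mono by fastforce
  also have "(\<Sum>i<r. real (card (D (g i))))
      \<le> (\<Sum>i<r. (real m / (real n - real m)) ^ Suc t * real (num_tables n m))"
    unfolding D_def using sumg by (intro sum_mono card_dominating_bound m(2)) auto
  finally have up: "real (card (D ?f)) \<le> real (card (matches n m r w a)) +
      real r * ((real m / (real n - real m)) ^ Suc t * real (num_tables n m))" by simp
  have "card (D ?f) = num_tables n (m - t)"
    unfolding D_def
  proof (rule card_dominating_eq[OF sumf _ m(1)])
    fix j assume "0 < ?f j"
    then have "a \<le> j" "\<not> r \<le> j - a" using w by (auto simp: shifted_def split: if_splits)
    then show "m \<le> j \<and> j < n" using a by linarith
  qed
  then show ?thesis
    using up num_tables_drop_lower[OF m] by (simp add: algebra_simps)
qed

lemma card_some_match: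
  fixes n m t :: nat and b :: "nat \<Rightarrow> nat"
  defines "u \<equiv> real m / (real n - real m)" and "v \<equiv> real (m - t) / (real n + real m)"
  assumes w: "\<forall>i\<ge>r. w i = 0" and t: "sum w {..<r} = t" and m: "t \<le> m" "m < n"
    and b: "\<And>l. l < N \<Longrightarrow> m \<le> b l \<and> b l + r \<le> n" "\<And>l l'. l < l' \<Longrightarrow> l' < N \<Longrightarrow> b l + r \<le> b l'"
    and pos: "real r * u ^ Suc t \<le> v ^ t"
  shows "(real N * (v ^ t - real r * u ^ Suc t))\<^sup>2 * real (num_tables n m)
    \<le> real (card (\<Union>l<N. matches n m r w (b l))) * (real N * u ^ t + (real N)\<^sup>2 * u ^ (2 * t))"
proof -
  let ?T = "real (num_tables n m)"
  have T: "0 < ?T" using num_tables_pos[OF m(2)] by simp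
  have u: "0 \<le> u" using m by (simp add: u_def)
  have "(real (card {..<N}) * ((v ^ t - real r * u ^ Suc t) * ?T))\<^sup>2
    \<le> real (card (\<Union>l\<in>{..<N}. matches n m r w (b l))) *
      (real (card {..<N}) * (u ^ t * ?T) + (real (card {..<N}))\<^sup>2 * (u ^ (2 * t) * ?T))"
  proof (rule second_moment_union[where S = "inv_tables n m"])
    show "(v ^ t - real r * u ^ Suc t) * ?T \<le> real (card (matches n m r w (b l)))" if "l \<in> {..<N}" for l
      unfolding u_def v_def using card_matches_ge[OF w t _ _ m, of "b l"] b(1)[of l] that by simp
    show "real (card (matches n m r w (b l))) \<le> u ^ t * ?T" if "l \<in> {..<N}" for l
      unfolding u_def using card_matches_le[OF w t _ m(2), of "b l"] b(1)[of l] that by simp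
    show "real (card (matches n m r w (b l) \<inter> matches n m r w (b l'))) \<le> u ^ (2 * t) * ?T"
      if "l \<in> {..<N}" "l' \<in> {..<N}" "l \<noteq> l'" for l l'
    proof (cases "l < l'")
      case True
      then show ?thesis
        unfolding u_def using card_matches_Int_le[OF w t _ _ m(2), of "b l" "b l'"] b that by simp
    next
      case False
      then have "l' < l" using that by simp
      then show ?thesis
        unfolding u_def using card_matches_Int_le[OF w t _ _ m(2), of "b l'" "b l"] b that
        by (simp add: Int_commute)
    qed
    show "0 \<le> (v ^ t - real r * u ^ Suc t) * ?T" using pos T by simp
    show "0 \<le> u ^ (2 * t) * ?T" using u by simp
  qed (auto simp: finite_inv_tables matches_def)
  then have "((real N * (v ^ t - real r * u ^ Suc t))\<^sup>2 * ?T) * ?T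
    \<le> (real (card (\<Union>l<N. matches n m r w (b l))) * (real N * u ^ t + (real N)\<^sup>2 * u ^ (2 * t))) * ?T"
    by (simp add: power2_eq_square algebra_simps)
  then show ?thesis using T by (rule mult_right_le_imp_le)
qed

section \<open>The probability of containing a pattern\<close>

abbreviation (input) contain_prob :: "nat list \<Rightarrow> nat \<Rightarrow> nat \<Rightarrow> real" where
  "contain_prob \<pi> n m \<equiv> measure_pmf.prob (random_perm n m) {\<sigma>. contains_pattern \<sigma> \<pi>}"

lemma finite_perms_with_inversions: "finite {\<sigma> \<in> n_permutations n. inversions \<sigma> = m}"
  by (simp add: n_permutations_def)

lemma card_perms_with_inversions:
  "card {\<sigma> \<in> n_permutations n. inversions \<sigma> = m} = num_tables n m"
  unfolding num_tables_def by (rule bij_betw_same_card[OF bij_betw_inv_table])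

lemma contain_prob_eq:
  assumes "{\<sigma> \<in> n_permutations n. inversions \<sigma> = m} \<noteq> {}"
  shows "contain_prob \<pi> n m =
    real (card {\<sigma> \<in> n_permutations n. inversions \<sigma> = m \<and> contains_pattern \<sigma> \<pi>}) / real (num_tables n m)"
proof -
  have "{\<sigma> \<in> n_permutations n. inversions \<sigma> = m} \<inter> {\<sigma>. contains_pattern \<sigma> \<pi>}
      = {\<sigma> \<in> n_permutations n. inversions \<sigma> = m \<and> contains_pattern \<sigma> \<pi>}" by auto
  then show ?thesis
    unfolding random_perm_def
    using measure_pmf_of_set[OF assms finite_perms_with_inversions, of "{\<sigma>. contains_pattern \<sigma> \<pi>}"]
    by (simp add: card_perms_with_inversions)
qed

lemma perms_with_inversions_ne:
  assumes "m < n"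
  shows "{\<sigma> \<in> n_permutations n. inversions \<sigma> = m} \<noteq> {}"
proof
  assume "{\<sigma> \<in> n_permutations n. inversions \<sigma> = m} = {}"
  then have "num_tables n m = 0" using card_perms_with_inversions[of n m] by (simp only: card.empty)
  then show False using num_tables_pos[OF assms] by simp
qed

text \<open>
  Complementation is an involution that exchanges the two sample spaces and preserves
  containment. The bound \<open>small\<close> ensures that these spaces are nonempty, as the uniform
  distribution on the empty set is unspecified.
\<close>

lemma contain_prob_complement:
  assumes m: "m \<le> n choose 2" and small: "(n choose 2) - m < n" and \<pi>: "\<pi> \<in> n_permutations k"
  shows "contain_prob \<pi> n m = contain_prob (complement_perm \<pi>) n ((n choose 2) - m)"
proof -
  let ?S = "\<lambda>m. {\<sigma> \<in> n_permutations n. inversions \<sigma> = m}"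
  let ?C = "\<lambda>m \<pi>. {\<sigma> \<in> n_permutations n. inversions \<sigma> = m \<and> contains_pattern \<sigma> \<pi>}"
  define m' where "m' = (n choose 2) - m"
  have inv: "inversions (complement_perm \<sigma>) = m' \<longleftrightarrow> inversions \<sigma> = m" if "\<sigma> \<in> n_permutations n" for \<sigma>
    using inversions_complement[OF that] m unfolding m'_def by arith
  have con: "contains_pattern (complement_perm \<sigma>) (complement_perm \<pi>) \<longleftrightarrow> contains_pattern \<sigma> \<pi>"
    if "\<sigma> \<in> n_permutations n" for \<sigma>
  proof
    assume "contains_pattern (complement_perm \<sigma>) (complement_perm \<pi>)"
    from contains_complement[OF complement_in_n_permutations[OF that] complement_in_n_permutations[OF \<pi>] this]
    show "contains_pattern \<sigma> \<pi>"
      by (simp only: complement_complement[OF that] complement_complement[OF \<pi>])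
  qed (rule contains_complement[OF that \<pi>])
  have inv': "inversions (complement_perm \<sigma>) = m \<longleftrightarrow> inversions \<sigma> = m'" if "\<sigma> \<in> n_permutations n" for \<sigma>
    using inv[OF complement_in_n_permutations[OF that]] complement_complement[OF that] by simp
  have con': "contains_pattern (complement_perm \<sigma>) \<pi> \<longleftrightarrow> contains_pattern \<sigma> (complement_perm \<pi>)"
    if "\<sigma> \<in> n_permutations n" for \<sigma>
    using con[OF complement_in_n_permutations[OF that]] complement_complement[OF that] by simp
  have bijS: "bij_betw complement_perm (?S m) (?S m')"
    by (rule bij_betwI[where g = complement_perm])
       (simp_all add: Pi_iff complement_in_n_permutations complement_complement[where n = n] inv inv')
  have bijC: "bij_betw complement_perm (?C m \<pi>) (?C m' (complement_perm \<pi>))"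
    by (rule bij_betwI[where g = complement_perm])
       (simp_all add: Pi_iff complement_in_n_permutations complement_complement[where n = n] inv inv' con con')
  have ne': "?S m' \<noteq> {}" using perms_with_inversions_ne small by (simp add: m'_def)
  then have "?S m \<noteq> {}" using bijS by (metis bij_betw_empty1)
  moreover have "num_tables n m = num_tables n m'"
    using bij_betw_same_card[OF bijS] card_perms_with_inversions by simp
  ultimately show ?thesis
    using contain_prob_eq[OF ne'] contain_prob_eq bij_betw_same_card[OF bijC]
    by (simp add: m'_def)
qed

text \<open>
  A first moment bound: containing \<open>\<pi>\<close> implies containing its component \<open>c\<close>, hence a heavy
  window, for which there are \<open>n\<close> places.
\<close>

lemma contain_prob_upper:
  assumes dec: "decomposition cs \<pi>" and c: "c \<in> set cs" and m: "m < n"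
  defines "s \<equiv> inversions c"
  shows "contain_prob \<pi> n m
    \<le> real n * real (Suc s ^ (length c * (2 * s + 1))) * (real m / (real n - real m)) ^ s"
proof -
  define L where "L = length c * (2 * s + 1)"
  let ?T = "real (num_tables n m)"
  have T: "0 < ?T" using num_tables_pos[OF m] by simp
  let ?C = "{\<sigma> \<in> n_permutations n. inversions \<sigma> = m \<and> contains_pattern \<sigma> \<pi>}"
  let ?H = "{e \<in> inv_tables n m. \<exists>a<n. s \<le> sum e {a..<a + L}}"
  have "inv_table ` ?C \<subseteq> ?H"
  proof
    fix e assume "e \<in> inv_table ` ?C"
    then obtain \<sigma> where \<sigma>: "\<sigma> \<in> n_permutations n" "inversions \<sigma> = m" "contains_pattern \<sigma> \<pi>"
      and e: "e = inv_table \<sigma>" by auto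
    have "e \<in> inv_tables n m"
      using bij_betw_inv_table[of n m] \<sigma> unfolding e bij_betw_def by blast
    moreover have "contains_pattern \<sigma> c"
      using contains_component[of \<sigma> cs c] \<sigma>(3) dec c by (simp add: decomposition_def)
    then obtain a where "a < length \<sigma>" "s \<le> sum e {a..<a + L}"
      using heavy_window_if_contains[of \<sigma> c] dec c
      unfolding e L_def s_def decomposition_def by blast
    ultimately show "e \<in> ?H" using n_permutations_length[OF \<sigma>(1)] by auto
  qed
  moreover have "inj_on inv_table ?C"
    by (rule inj_on_subset[OF inj_on_inv_table[of n]]) auto
  moreover have "finite ?H" by (simp add: finite_inv_tables)
  ultimately have "card ?C \<le> card ?H" by (meson card_inj_on_le)
  then have "real (card ?C) \<le> real n * real (Suc s ^ L) * (real m / (real n - real m)) ^ s * ?T"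
    using card_heavy_window[OF m, of s L] by (meson of_nat_le_iff order_trans)
  then show ?thesis
    using contain_prob_eq[OF perms_with_inversions_ne[OF m], of \<pi>] T
    by (simp add: L_def pos_divide_le_eq)
qed

text \<open>
  The positions from \<open>h\<close> on are cut into one stretch per component, and each stretch into \<open>N\<close>
  disjoint windows of length \<open>k\<close>. If every stretch has a window matching its component, then \<open>\<pi>\<close>
  occurs.
\<close>

lemma contain_prob_lower:
  fixes cs :: "nat list list" and n m h N k :: nat
  defines "F \<equiv> \<lambda>i. \<Union>l<N. matches n m (length (cs ! i)) (inv_table (cs ! i)) (h + (i * N + l) * k)"
  assumes dec: "decomposition cs \<pi>" and m: "m < n"
    and k: "\<And>c. c \<in> set cs \<Longrightarrow> length c \<le> k" and fit: "h + length cs * N * k \<le> n"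
  shows "1 - (\<Sum>i<length cs. 1 - real (card (F i)) / real (num_tables n m)) \<le> contain_prob \<pi> n m"
proof -
  let ?T = "real (num_tables n m)"
  have T: "0 < ?T" using num_tables_pos[OF m] by simp
  let ?S = "{\<sigma> \<in> n_permutations n. inversions \<sigma> = m}"
  let ?C = "{\<sigma> \<in> n_permutations n. inversions \<sigma> = m \<and> contains_pattern \<sigma> \<pi>}"
  have perms: "distinct c \<and> set c = {1..length c}" if "c \<in> set cs" for c
    using dec that by (auto simp: decomposition_def indecomposable_def n_permutations_iff)
  have FE: "F i \<subseteq> inv_tables n m" for i by (auto simp: F_def matches_def)
  have "inv_table ` (?S - ?C) \<subseteq> (\<Union>i<length cs. inv_tables n m - F i)"
  proof
    fix e assume "e \<in> inv_table ` (?S - ?C)"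
    then obtain \<sigma> where \<sigma>: "\<sigma> \<in> n_permutations n" "inversions \<sigma> = m" "\<not> contains_pattern \<sigma> \<pi>"
      and e: "e = inv_table \<sigma>" by auto
    have eE: "e \<in> inv_tables n m"
      using bij_betw_inv_table[of n m] \<sigma> unfolding e bij_betw_def by blast
    have "\<exists>i<length cs. e \<notin> F i"
    proof (rule ccontr)
      assume "\<not> ?thesis"
      then have "\<forall>i<length cs. \<exists>l<N. e \<in> matches n m (length (cs ! i)) (inv_table (cs ! i)) (h + (i * N + l) * k)"
        by (auto simp: F_def)
      then obtain l where l: "\<And>i. i < length cs \<Longrightarrow> l i < N"
        "\<And>i. i < length cs \<Longrightarrow> e \<in> matches n m (length (cs ! i)) (inv_table (cs ! i)) (h + (i * N + l i) * k)"
        by metis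
      define b where "b i = h + (i * N + l i) * k" for i
      have step: "b i + length (cs ! i) \<le> h + Suc i * N * k" if "i < length cs" for i
      proof -
        have "length (cs ! i) \<le> k" using k that by simp
        moreover have "(i * N + l i) * k + k \<le> Suc i * N * k"
        proof -
          have "(i * N + l i) * k + k = (i * N + l i + 1) * k" by simp
          also have "\<dots> \<le> Suc i * N * k" using l(1)[OF that] by (intro mult_right_mono) auto
          finally show ?thesis .
        qed
        ultimately show ?thesis by (simp add: b_def)
      qed
      have "contains_pattern \<sigma> (foldr direct_sum cs [])"
      proof (rule contains_if_windows[where b = b])
        show "distinct \<sigma>" using \<sigma>(1) by (simp add: n_permutations_iff)
        show "distinct c \<and> set c = {1..length c}" if "c \<in> set cs" for c using perms[OF that] .
        show "b i + length (cs ! i) \<le> length \<sigma>" if "i < length cs" for i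
        proof -
          have "Suc i * N * k \<le> length cs * N * k" using that by (intro mult_right_mono) auto
          then show ?thesis using step[OF that] fit n_permutations_length[OF \<sigma>(1)] by linarith
        qed
        show "b i + length (cs ! i) \<le> b (Suc i)" if "Suc i < length cs" for i
        proof -
          have "Suc i * N * k \<le> (Suc i * N + l (Suc i)) * k" by (intro mult_right_mono) auto
          then show ?thesis using step[of i] that unfolding b_def by linarith
        qed
        show "inv_table \<sigma> (b i + j) = inv_table (cs ! i) j"
          if "i < length cs" "j < length (cs ! i)" for i j
          using l(2)[OF that(1)] that(2) by (simp add: matches_def b_def e)
      qed
      then show False using \<sigma>(3) dec by (simp add: decomposition_def)
    qed
    then show "e \<in> (\<Union>i<length cs. inv_tables n m - F i)" using eE by blast
  qed
  moreover have "inj_on inv_table (?S - ?C)"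
    by (rule inj_on_subset[OF inj_on_inv_table[of n]]) auto
  ultimately have "card (?S - ?C) \<le> card (\<Union>i<length cs. inv_tables n m - F i)"
    by (intro card_inj_on_le) (auto simp: finite_inv_tables)
  also have "\<dots> \<le> (\<Sum>i<length cs. card (inv_tables n m - F i))" by (rule card_UN_le) simp
  finally have "real (card (?S - ?C)) \<le> (\<Sum>i<length cs. real (card (inv_tables n m - F i)))"
    using of_nat_mono by fastforce
  also have "\<dots> = (\<Sum>i<length cs. ?T - real (card (F i)))"
  proof (rule sum.cong)
    fix i
    have "card (F i) \<le> num_tables n m"
      unfolding num_tables_def using FE finite_inv_tables by (intro card_mono) auto
    then show "real (card (inv_tables n m - F i)) = ?T - real (card (F i))"
      using FE[of i] finite_subset[OF FE finite_inv_tables]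
      by (simp add: card_Diff_subset num_tables_def)
  qed simp
  finally have "real (card (?S - ?C)) / ?T \<le> (\<Sum>i<length cs. ?T - real (card (F i))) / ?T"
    using T by (intro divide_right_mono) auto
  also have "\<dots> = (\<Sum>i<length cs. 1 - real (card (F i)) / ?T)"
    using T by (simp add: sum_divide_distrib diff_divide_distrib)
  finally have miss: "real (card (?S - ?C)) / ?T \<le> (\<Sum>i<length cs. 1 - real (card (F i)) / ?T)" .
  have sub: "?C \<subseteq> ?S" by auto
  have "card ?C \<le> card ?S" by (rule card_mono[OF finite_perms_with_inversions sub])
  moreover have "card (?S - ?C) = card ?S - card ?C"
    by (rule card_Diff_subset[OF finite_subset[OF sub finite_perms_with_inversions] sub])
  ultimately have "real (card (?S - ?C)) = ?T - real (card ?C)"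
    by (simp add: card_perms_with_inversions)
  then have "real (card (?S - ?C)) / ?T = 1 - contain_prob \<pi> n m"
    using contain_prob_eq[OF perms_with_inversions_ne[OF m], of \<pi>] T
    by (simp add: diff_divide_distrib)
  then show ?thesis using miss by simp
qed

section \<open>Limits\<close>

text \<open>
  The threshold \<open>m = n powr (1 - 1 / s)\<close> is where \<open>n * (m / n) ^ s\<close>, the order of magnitude of
  the expected number of windows with \<open>s\<close> inversions, is \<open>1\<close>.
\<close>

lemma scaled_power_identity:
  assumes "0 < n" "0 < s"
  shows "real n * (x / real n) ^ s = (x / real n powr (1 - 1 / real s)) ^ s"
proof -
  have "(real n powr (1 - 1 / real s)) ^ s = real n powr ((1 - 1 / real s) * real s)"
    using assms by (simp add: powr_powr flip: powr_realpow)
  also have "(1 - 1 / real s) * real s = real s - 1" using assms by (simp add: field_simps)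
  also have "real n powr (real s - 1) = real n ^ s / real n"
    using assms by (simp add: powr_diff powr_realpow)
  finally show ?thesis using assms by (simp add: power_divide)
qed

lemma perm_components_ne:
  assumes "\<pi> \<in> n_permutations k" "1 \<le> k"
  shows "perm_components \<pi> \<noteq> []"
proof
  assume "perm_components \<pi> = []"
  then have "\<pi> = []"
    using decomposition_perm_components[OF assms(1)] by (simp add: decomposition_def)
  then show False using n_permutations_length[OF assms(1)] assms(2) by simp
qed

lemma contain_prob_tendsto_0:
  fixes m :: "nat \<Rightarrow> nat"
  assumes \<pi>: "\<pi> \<in> n_permutations k" "1 \<le> k" and s: "s = max_component_inversions \<pi>" "0 < s"
    and m: "(\<lambda>n. real (m n)) \<in> o(\<lambda>n. real n powr (1 - 1 / real s))"
  shows "(\<lambda>n. contain_prob \<pi> n (m n)) \<longlonglongrightarrow> 0"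
proof -
  define cs where "cs = perm_components \<pi>"
  have dec: "decomposition cs \<pi>" using decomposition_perm_components[OF \<pi>(1)] by (simp add: cs_def)
  have "s \<in> inversions ` set cs"
    using Max_in[of "inversions ` set cs"] perm_components_ne[OF \<pi>] s(1)
    by (simp add: max_component_inversions_def cs_def)
  then obtain c where c: "c \<in> set cs" "inversions c = s" by auto
  define z where "z n = real (m n) / real n powr (1 - 1 / real s)" for n
  have z: "z \<longlonglongrightarrow> 0" unfolding z_def by (rule smalloD_tendsto[OF m])
  define K where "K = real (Suc s ^ (length c * (2 * s + 1)))"
  have "\<forall>\<^sub>F n in sequentially. z n < 1 / 2" using z by (rule order_tendstoD(2)) simp
  then have upper: "\<forall>\<^sub>F n in sequentially. contain_prob \<pi> n (m n) \<le> K * 2 ^ s * z n ^ s"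
    using eventually_gt_at_top[of 0]
  proof eventually_elim
    case (elim n)
    have "real n powr (1 - 1 / real s) \<le> real n powr 1"
      using elim by (intro powr_mono) auto
    then have "real (m n) / real n \<le> z n"
      unfolding z_def using elim by (intro divide_left_mono) auto
    then have "real (m n) / real n < 1 / 2" using elim(1) by linarith
    then have half: "real (m n) < real n / 2" using elim(2) by (simp add: divide_less_eq)
    then have "real (m n) / (real n - real (m n)) \<le> real (m n) / (real n / 2)"
      using elim by (intro divide_left_mono) auto
    then have u: "real (m n) / (real n - real (m n)) \<le> 2 * (real (m n) / real n)" by (simp add: mult.commute)
    have "contain_prob \<pi> n (m n) \<le> real n * K * (real (m n) / (real n - real (m n))) ^ s"
      using contain_prob_upper[OF dec c(1), of "m n" n] half c(2) by (simp add: K_def)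
    also have "\<dots> \<le> real n * K * (2 * (real (m n) / real n)) ^ s"
      using half by (intro mult_left_mono power_mono u) (auto simp: K_def)
    also have "\<dots> = K * 2 ^ s * (real n * (real (m n) / real n) ^ s)"
      unfolding power_mult_distrib by (simp only: mult_ac)
    also have "\<dots> = K * 2 ^ s * z n ^ s"
      using elim s(2) by (simp only: scaled_power_identity z_def)
    finally show ?case .
  qed
  have "(\<lambda>n. K * 2 ^ s * z n ^ s) \<longlonglongrightarrow> K * 2 ^ s * 0 ^ s"
    by (intro tendsto_intros z)
  then have lim: "(\<lambda>n. K * 2 ^ s * z n ^ s) \<longlonglongrightarrow> 0" using s(2) by (simp add: power_0_left)
  show ?thesis
    by (rule tendsto_sandwich[OF _ upper tendsto_const lim]) simp
qed

text \<open>
  With \<open>y\<close> of the order of the expected number of matches, the second moment method bounds the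
  fraction of tables with a match below by \<open>q\<^sup>2 * y / (1 + y)\<close>. Here \<open>q\<close> tends to \<open>1\<close> because the
  lower and upper estimates of \<open>num_tables\<close> agree to first order, and \<open>y\<close> tends to infinity because
  matching at most \<open>s\<close> inversions is at least as likely as matching \<open>s\<close>.
\<close>

lemma some_match_tendsto_1:
  fixes m N :: "nat \<Rightarrow> nat" and b :: "nat \<Rightarrow> nat \<Rightarrow> nat"
  assumes m0: "(\<lambda>n. real (m n) / real n) \<longlonglongrightarrow> 0"
    and minf: "filterlim (\<lambda>n. real (m n)) at_top sequentially"
    and N: "filterlim (\<lambda>n. real (N n) * (real (m n) / real n) ^ s) at_top sequentially"
    and w: "\<forall>i\<ge>r. w i = 0" and t: "sum w {..<r} = t" "t \<le> s"
    and b: "\<forall>\<^sub>F n in sequentially. \<forall>l<N n. m n \<le> b n l \<and> b n l + r \<le> n"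
      "\<And>n l l'. l < l' \<Longrightarrow> b n l + r \<le> b n l'"
  shows "(\<lambda>n. real (card (\<Union>l<N n. matches n (m n) r w (b n l))) / real (num_tables n (m n))) \<longlonglongrightarrow> 1"
    (is "?P \<longlonglongrightarrow> 1")
proof -
  define x where "x n = real (m n) / real n" for n
  define u where "u n = real (m n) / (real n - real (m n))" for n
  define v where "v n = real (m n - t) / (real n + real (m n))" for n
  define y where "y n = real (N n) * u n ^ t" for n
  define q where "q n = (v n / u n) ^ t - real r * u n" for n
  have x: "x \<longlonglongrightarrow> 0" using m0 by (simp add: x_def[abs_def])
  have small: "\<forall>\<^sub>F n in sequentially. x n < 1" using x by (rule order_tendstoD(2)) simp
  have big: "\<forall>\<^sub>F n in sequentially. real t + 1 \<le> real (m n)"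
    using minf by (auto simp: filterlim_at_top)
  have regime: "\<forall>\<^sub>F n in sequentially. 0 < n \<and> t < m n \<and> m n < n"
    using small big eventually_gt_at_top[of 0]
  proof eventually_elim
    case (elim n)
    then show ?case by (simp add: x_def field_simps)
  qed
  have "(\<lambda>n. x n / (1 - x n)) \<longlonglongrightarrow> 0 / (1 - 0)" by (intro tendsto_intros x) simp
  moreover have "\<forall>\<^sub>F n in sequentially. x n / (1 - x n) = u n"
    using regime by eventually_elim (simp add: x_def u_def field_simps)
  ultimately have u: "u \<longlonglongrightarrow> 0" using Lim_transform_eventually by fastforce
  have "(\<lambda>n. real t / real (m n)) \<longlonglongrightarrow> 0"
    using minf by (rule tendsto_divide_0[OF tendsto_const filterlim_at_top_imp_at_infinity])
  then have "(\<lambda>n. (1 - real t / real (m n)) * (1 - x n) / (1 + x n)) \<longlonglongrightarrow> (1 - 0) * (1 - 0) / (1 + 0)"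
    by (intro tendsto_intros x) simp_all
  moreover have "\<forall>\<^sub>F n in sequentially. (1 - real t / real (m n)) * (1 - x n) / (1 + x n) = v n / u n"
    using regime
  proof eventually_elim
    case (elim n)
    then have "real (m n - t) = real (m n) - real t" by simp
    moreover have "0 < real n + real (m n)" "0 < real n - real (m n)" "0 < real (m n)" "0 < real n"
      using elim by auto
    ultimately show ?case
      by (simp add: x_def u_def v_def divide_simps)
  qed
  ultimately have "(\<lambda>n. v n / u n) \<longlonglongrightarrow> 1" using Lim_transform_eventually by fastforce
  then have "q \<longlonglongrightarrow> 1 ^ t - real r * 0"
    unfolding q_def[abs_def] by (intro tendsto_intros u)
  then have q: "q \<longlonglongrightarrow> 1" by simp
  have qpos: "\<forall>\<^sub>F n in sequentially. 0 < q n" using q by (rule order_tendstoD(1)) simp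
  have "\<forall>\<^sub>F n in sequentially. real (N n) * (real (m n) / real n) ^ s \<le> y n"
    using regime
  proof eventually_elim
    case (elim n)
    have "x n ^ s \<le> x n ^ t"
      using elim t(2) by (intro power_decreasing) (auto simp: x_def)
    also have "\<dots> \<le> u n ^ t"
      unfolding x_def u_def using elim by (intro power_mono divide_left_mono) auto
    finally show ?case by (auto simp: y_def x_def intro: mult_left_mono)
  qed
  then have y: "filterlim y at_top sequentially" by (rule filterlim_at_top_mono[OF N])
  have ypos: "\<forall>\<^sub>F n in sequentially. 0 < y n"
    using y by (auto simp: filterlim_at_top_dense)
  have "filterlim (\<lambda>n. 1 + y n) at_top sequentially"
    by (rule filterlim_tendsto_add_at_top[OF tendsto_const y])
  then have "(\<lambda>n. 1 / (1 + y n)) \<longlonglongrightarrow> 0"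
    by (rule tendsto_divide_0[OF tendsto_const filterlim_at_top_imp_at_infinity])
  then have "(\<lambda>n. (q n)\<^sup>2 * (1 - 1 / (1 + y n))) \<longlonglongrightarrow> 1\<^sup>2 * (1 - 0)"
    by (intro tendsto_intros q)
  then have lim: "(\<lambda>n. (q n)\<^sup>2 * (1 - 1 / (1 + y n))) \<longlonglongrightarrow> 1" by simp
  have lower: "\<forall>\<^sub>F n in sequentially. (q n)\<^sup>2 * (1 - 1 / (1 + y n)) \<le> ?P n"
    using regime qpos ypos b(1)
  proof eventually_elim
    case (elim n)
    let ?U = "real (card (\<Union>l<N n. matches n (m n) r w (b n l)))" and ?T = "real (num_tables n (m n))"
    have T: "0 < ?T" using num_tables_pos elim by simp
    have up: "0 < u n" using elim by (simp add: u_def)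
    have split: "v n ^ t - real r * u n ^ Suc t = u n ^ t * q n"
      using up by (simp add: q_def power_divide field_simps)
    then have "real r * u n ^ Suc t \<le> v n ^ t" using up elim by (smt (verit) mult_pos_pos zero_less_power)
    then have "(real (N n) * (v n ^ t - real r * u n ^ Suc t))\<^sup>2 * ?T
      \<le> ?U * (real (N n) * u n ^ t + (real (N n))\<^sup>2 * u n ^ (2 * t))"
      unfolding u_def v_def using elim b(2)
      by (intro card_some_match[OF w t(1)]) auto
    then have "y n * (y n * (q n)\<^sup>2 * ?T) \<le> y n * (?U * (1 + y n))"
      unfolding split y_def by (simp add: power2_eq_square power_mult algebra_simps)
    then have "y n * (q n)\<^sup>2 * ?T \<le> ?U * (1 + y n)"
      using elim(3) by (simp only: mult_le_cancel_left_pos)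
    then have "(q n)\<^sup>2 * (y n / (1 + y n)) \<le> ?U / ?T"
      using T elim(3) by (simp add: divide_simps mult_ac)
    moreover have "1 - 1 / (1 + y n) = y n / (1 + y n)" using elim(3) by (simp add: field_simps)
    ultimately show ?case by simp
  qed
  have upper: "\<forall>\<^sub>F n in sequentially. ?P n \<le> 1"
  proof (rule always_eventually, rule allI)
    fix n
    have "card (\<Union>l<N n. matches n (m n) r w (b n l)) \<le> num_tables n (m n)"
      unfolding num_tables_def by (rule card_mono[OF finite_inv_tables]) (auto simp: matches_def)
    then show "?P n \<le> 1" by (cases "num_tables n (m n) = 0") simp_all
  qed
  show ?thesis by (rule tendsto_sandwich[OF lower upper lim tendsto_const])
qed

text \<open>
  The windows occupy the second half of the positions, which leaves room for \<open>m\<close> positions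
  before them, so that the constraint \<open>e j \<le> j\<close> is not felt.
\<close>

lemma contain_prob_tendsto_1:
  fixes m :: "nat \<Rightarrow> nat"
  assumes \<pi>: "\<pi> \<in> n_permutations k" "1 \<le> k" and s: "s = max_component_inversions \<pi>" "0 < s"
    and m: "(\<lambda>n. real n powr (1 - 1 / real s)) \<in> o(\<lambda>n. real (m n))"
      "(\<lambda>n. real (m n)) \<in> o(\<lambda>n. real n)"
  shows "(\<lambda>n. contain_prob \<pi> n (m n)) \<longlonglongrightarrow> 1"
proof -
  define cs where "cs = perm_components \<pi>"
  have dec: "decomposition cs \<pi>" using decomposition_perm_components[OF \<pi>(1)] by (simp add: cs_def)
  have inv_le: "inversions c \<le> s" if "c \<in> set cs" for c
    using that s(1) by (simp add: max_component_inversions_def cs_def)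
  \<comment> \<open>a common window length for all components; the successor only makes it visibly positive\<close>
  define K where "K = Suc (sum_list (map length cs))"
  have K: "length c \<le> K" if "c \<in> set cs" for c
    using member_le_sum_list[of "length c" "map length cs"] that by (simp add: K_def)
  define M where "M = length cs * K"
  have M: "0 < M" using perm_components_ne[OF \<pi>] by (simp add: M_def K_def cs_def)
  define N where "N n = (n - n div 2) div M" for n
  define x where "x n = real (m n) / real n" for n
  have x: "x \<longlonglongrightarrow> 0" unfolding x_def by (rule smalloD_tendsto[OF m(2)])
  define z where "z n = real (m n) / real n powr (1 - 1 / real s)" for n
  have z0: "(\<lambda>n. real n powr (1 - 1 / real s) / real (m n)) \<longlonglongrightarrow> 0"
    by (rule smalloD_tendsto[OF m(1)])
  have mpos: "\<forall>\<^sub>F n in sequentially. 0 < m n"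
    using landau_o.smallD[OF m(1) zero_less_one] eventually_gt_at_top[of 0]
  proof eventually_elim
    case (elim n)
    then have "0 < real n powr (1 - 1 / real s)" by simp
    then show ?case using elim by (cases "m n") auto
  qed
  have "filterlim (\<lambda>n. inverse (real n powr (1 - 1 / real s) / real (m n))) at_top sequentially"
    by (rule filterlim_inverse_at_top[OF z0])
       (use mpos eventually_gt_at_top[of 0] in eventually_elim, simp)
  then have z: "filterlim z at_top sequentially" by (simp add: z_def[abs_def])
  have minf: "filterlim (\<lambda>n. real (m n)) at_top sequentially"
  proof (rule filterlim_at_top_mono[OF z])
    show "\<forall>\<^sub>F n in sequentially. z n \<le> real (m n)"
      using eventually_gt_at_top[of 0]
    proof eventually_elim
      case (elim n)
      have "1 \<le> real n powr (1 - 1 / real s)"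
        using elim s(2) by (intro ge_one_powr_ge_zero) auto
      then show ?case by (simp add: z_def divide_le_eq mult_le_cancel_left1)
    qed
  qed
  have N_inf: "filterlim (\<lambda>n. real (N n) * (real (m n) / real n) ^ s) at_top sequentially"
  proof -
    have "filterlim (\<lambda>n. z n ^ s) at_top sequentially"
      using filterlim_pow_at_top[OF s(2) z] .
    then have zs: "filterlim (\<lambda>n. 1 / (2 * real M) * z n ^ s) at_top sequentially"
      using M by (intro filterlim_tendsto_pos_mult_at_top[OF tendsto_const]) auto
    have "(\<lambda>n. - (x n ^ s)) \<longlonglongrightarrow> - (0 ^ s)" by (intro tendsto_intros x)
    from filterlim_tendsto_add_at_top[OF this zs] show ?thesis
    proof (rule filterlim_at_top_mono)
      show "\<forall>\<^sub>F n in sequentially. - (x n ^ s) + 1 / (2 * real M) * z n ^ s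
          \<le> real (N n) * (real (m n) / real n) ^ s"
        using eventually_gt_at_top[of 0]
      proof eventually_elim
        case (elim n)
        \<comment> \<open>rounding in \<open>N\<close> loses at most \<open>x n ^ s\<close>, which is negligible\<close>
        have "n - n div 2 < (N n + 1) * M"
          using M dividend_less_div_times[of M "n - n div 2"] by (simp add: N_def)
        then have "real (n - n div 2) \<le> (real (N n) + 1) * real M"
          by (metis less_imp_le of_nat_1 of_nat_add of_nat_le_iff of_nat_mult)
        moreover have "real n / 2 \<le> real (n - n div 2)" by linarith
        ultimately have "real n / 2 \<le> (real (N n) + 1) * real M" by linarith
        then have "real n / (2 * real M) \<le> real (N n) + 1" using M by (simp add: field_simps)
        then have "real n / (2 * real M) * x n ^ s \<le> (real (N n) + 1) * x n ^ s"
          by (rule mult_right_mono) (simp add: x_def)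
        moreover have "real n / (2 * real M) * x n ^ s = 1 / (2 * real M) * z n ^ s"
          using scaled_power_identity[OF elim s(2), of "real (m n)"] by (simp add: x_def z_def)
        moreover have "(real (N n) + 1) * x n ^ s = real (N n) * x n ^ s + x n ^ s"
          by (simp add: algebra_simps)
        ultimately have "1 / (2 * real M) * z n ^ s \<le> real (N n) * x n ^ s + x n ^ s"
          by linarith
        then show ?case unfolding x_def by linarith
      qed
    qed
  qed
  have half: "\<forall>\<^sub>F n in sequentially. m n \<le> n div 2 \<and> m n < n"
  proof -
    have "\<forall>\<^sub>F n in sequentially. x n < 1 / 4" using x by (rule order_tendstoD(2)) simp
    then show ?thesis
      using eventually_gt_at_top[of 4]
    proof eventually_elim
      case (elim n)
      then have "4 * real (m n) < real n" by (simp add: x_def divide_less_eq)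
      then show ?case by linarith
    qed
  qed
  have fit: "n div 2 + length cs * N n * K \<le> n" for n
  proof -
    have "N n * M \<le> n - n div 2" by (simp add: N_def)
    then have "length cs * N n * K \<le> n - n div 2" by (simp add: M_def mult_ac)
    then show ?thesis by linarith
  qed
  define F where "F i n = (\<Union>l<N n. matches n (m n) (length (cs ! i)) (inv_table (cs ! i))
    (n div 2 + (i * N n + l) * K))" for i n
  have block: "(\<lambda>n. real (card (F i n)) / real (num_tables n (m n))) \<longlonglongrightarrow> 1" if i: "i < length cs" for i
    unfolding F_def
  proof (rule some_match_tendsto_1[OF _ minf N_inf])
    show "(\<lambda>n. real (m n) / real n) \<longlonglongrightarrow> 0" using x by (simp add: x_def[abs_def])
    show "\<forall>j\<ge>length (cs ! i). inv_table (cs ! i) j = 0" by (simp add: inv_table_def)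
    show "sum (inv_table (cs ! i)) {..<length (cs ! i)} = inversions (cs ! i)"
      by (rule inversions_eq_sum_inv_table[symmetric])
    show "inversions (cs ! i) \<le> s" using inv_le i by simp
    have Ki: "length (cs ! i) \<le> K" using K i by simp
    show "\<forall>\<^sub>F n in sequentially. \<forall>l<N n. m n \<le> n div 2 + (i * N n + l) * K \<and>
        n div 2 + (i * N n + l) * K + length (cs ! i) \<le> n"
      using half
    proof eventually_elim
      case (elim n)
      have "n div 2 + (i * N n + l) * K + length (cs ! i) \<le> n" if "l < N n" for l
      proof -
        have "i * N n + l + 1 \<le> Suc i * N n" using that by simp
        also have "\<dots> \<le> length cs * N n" using i by (intro mult_right_mono) auto
        finally have "(i * N n + l + 1) * K \<le> length cs * N n * K" by (rule mult_right_mono) simp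
        moreover have "(i * N n + l + 1) * K = (i * N n + l) * K + K" by simp
        ultimately show ?thesis using fit[of n] Ki by linarith
      qed
      then show ?case using elim by (auto intro: trans_le_add1)
    qed
    show "n div 2 + (i * N n + l) * K + length (cs ! i) \<le> n div 2 + (i * N n + l') * K"
      if "l < l'" for n l l'
    proof -
      have "(i * N n + l + 1) * K \<le> (i * N n + l') * K" using that by (intro mult_right_mono) auto
      moreover have "(i * N n + l + 1) * K = (i * N n + l) * K + K" by simp
      ultimately show ?thesis using Ki by linarith
    qed
  qed
  have "(\<lambda>n. 1 - (\<Sum>i<length cs. 1 - real (card (F i n)) / real (num_tables n (m n))))
      \<longlonglongrightarrow> 1 - (\<Sum>i<length cs. 1 - 1)"
    by (intro tendsto_intros block) simp
  then have lim: "(\<lambda>n. 1 - (\<Sum>i<length cs. 1 - real (card (F i n)) / real (num_tables n (m n)))) \<longlonglongrightarrow> 1"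
    by simp
  have "\<forall>\<^sub>F n in sequentially. 1 - (\<Sum>i<length cs. 1 - real (card (F i n)) / real (num_tables n (m n)))
      \<le> contain_prob \<pi> n (m n)"
    using half
  proof eventually_elim
    case (elim n)
    show ?case
      unfolding F_def by (rule contain_prob_lower[OF dec _ K fit]) (use elim in auto)
  qed
  then show ?thesis
    by (rule tendsto_sandwich[OF _ _ lim tendsto_const]) simp
qed

theorem theorem2:
  fixes \<pi> :: "nat list" and k s s' :: nat and m :: "nat \<Rightarrow> nat"
  assumes "k \<ge> 1" and "\<pi> \<in> n_permutations k"
    and "s = max_component_inversions \<pi>"
    and "s' = max_component_inversions (complement_perm \<pi>)"
    and "\<And>n. m n \<le> n choose 2"
  shows
    "(s > 0 \<longrightarrow>
       ((\<lambda>n. real (m n)) \<in> o(\<lambda>n. real n powr (1 - 1 / real s)) \<longrightarrow>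
         (\<lambda>n. measure_pmf.prob (random_perm n (m n)) {\<sigma>. contains_pattern \<sigma> \<pi>}) \<longlonglongrightarrow> 0) \<and>
       ((\<lambda>n. real n powr (1 - 1 / real s)) \<in> o(\<lambda>n. real (m n)) \<and>
        (\<lambda>n. real (m n)) \<in> o(\<lambda>n. real n) \<longrightarrow>
         (\<lambda>n. measure_pmf.prob (random_perm n (m n)) {\<sigma>. contains_pattern \<sigma> \<pi>}) \<longlonglongrightarrow> 1)) \<and>
     (s' > 0 \<longrightarrow>
       ((\<lambda>n. real (n choose 2) - real (m n)) \<in> o(\<lambda>n. real n) \<and>
        (\<lambda>n. real n powr (1 - 1 / real s')) \<in> o(\<lambda>n. real (n choose 2) - real (m n)) \<longrightarrow>
         (\<lambda>n. measure_pmf.prob (random_perm n (m n)) {\<sigma>. contains_pattern \<sigma> \<pi>}) \<longlonglongrightarrow> 1) \<and>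
       ((\<lambda>n. real (n choose 2) - real (m n)) \<in> o(\<lambda>n. real n powr (1 - 1 / real s')) \<longrightarrow>
         (\<lambda>n. measure_pmf.prob (random_perm n (m n)) {\<sigma>. contains_pattern \<sigma> \<pi>}) \<longlonglongrightarrow> 0))"
proof -
  define d where "d n = (n choose 2) - m n" for n
  have d: "(\<lambda>n. real (n choose 2) - real (m n)) = (\<lambda>n. real (d n))"
    using assms(5) by (simp add: d_def of_nat_diff)
  note \<pi>' = complement_in_n_permutations[OF assms(2)]
  have transfer: "(\<lambda>n. contain_prob \<pi> n (m n)) \<longlonglongrightarrow> p"
    if lim: "(\<lambda>n. contain_prob (complement_perm \<pi>) n (d n)) \<longlonglongrightarrow> p"
      and o: "(\<lambda>n. real (d n)) \<in> o(\<lambda>n. real n)" for p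
  proof -
    have "\<forall>\<^sub>F n in sequentially. real (d n) / real n < 1"
      using smalloD_tendsto[OF o] by (rule order_tendstoD(2)) simp
    then have "\<forall>\<^sub>F n in sequentially. contain_prob (complement_perm \<pi>) n (d n) = contain_prob \<pi> n (m n)"
      using eventually_gt_at_top[of 0]
    proof eventually_elim
      case (elim n)
      then have "d n < n" by (simp add: field_simps)
      then show ?case
        using contain_prob_complement[OF assms(5)[of n] _ assms(2)] by (simp add: d_def)
    qed
    with lim show ?thesis by (rule Lim_transform_eventually)
  qed
  have sparse: "(\<lambda>n. real (d n)) \<in> o(\<lambda>n. real n)"
    if "(\<lambda>n. real (d n)) \<in> o(\<lambda>n. real n powr (1 - 1 / real s'))"
  proof (rule landau_o.small_big_trans[OF that])
    have "\<forall>\<^sub>F n in sequentially. norm (real n powr (1 - 1 / real s')) \<le> 1 * norm (real n)"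
      using eventually_gt_at_top[of 0]
    proof eventually_elim
      case (elim n)
      then have "real n powr (1 - 1 / real s') \<le> real n powr 1" by (intro powr_mono) auto
      then show ?case by simp
    qed
    then show "(\<lambda>n. real n powr (1 - 1 / real s')) \<in> O(\<lambda>n. real n)" by (rule landau_o.bigI[OF zero_less_one])
  qed
  show ?thesis
    unfolding d
    using contain_prob_tendsto_0[OF assms(2,1,3)] contain_prob_tendsto_1[OF assms(2,1,3)]
      contain_prob_tendsto_0[OF \<pi>' assms(1,4)] contain_prob_tendsto_1[OF \<pi>' assms(1,4)]
      transfer sparse
    by blast
qed

end
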